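(* Suppose $\alpha \vdash n$ and $\theta \vdash k$ with $\theta \subseteq \alpha$. Then \[ s_{\alpha/\theta} \ast s_{(n-k-1,1)} = \bigl(\#\mathrm{corners}(\alpha) - \#\mathrm{corners}(\theta) - 1\bigr)\,s_{\alpha/\theta} + \sum_{\beta \in \alpha^{\mp}} s_{\beta/\theta} - \sum_{\phi \in \theta^{\mp}} s_{\alpha/\phi}. \]
   Context: Partitions are identified with their Young diagrams. A corner of a partition $\alpha$ is a box of $\alpha$ whose removal results in another partition; $\#\mathrm{corners}(\alpha)$ is the number of corners. $\alpha^{\mp}$ is the set of partitions not equal to $\alpha$ that can be obtained by removing a corner of $\alpha$ and then adding a box to the result. $s_{\alpha/\theta}$ is the skew Schur function, with $s_{\alpha/\theta}=0$ if $\theta\not\subseteq\alpha$. The Kronecker product $\ast$ is the bilinear product on symmetric functions (over $\mathbb{Q}$) with $p_\lambda\ast p_\mu=\delta_{\lambda\mu}z_\lambda p_\lambda$, where $z_\lambda=\prod_i i^{m_i}m_i!$ and $m_i$ is the number of parts of $\lambda$ equal to $i$. When $(n-k-1,1)$ is not a partition, $s_{(n-k-1,1)}$ is defined by the Jacobi--Trudi formula $s_{(\alpha_1,\ldots,\alpha_N)}=\det(h_{\alpha_i+j-i})_{i,j=1,\ldots,N}$, with $h_0=1$ and $h_m=0$ for $m<0$. *)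

theory Defs
  imports "HOL-Library.Multiset" "Jordan_Normal_Form.Determinant"
begin

section \<open>Formal power series over the rationals in the variables $x_0, x_1, x_2, \ldots$\<close>

text \<open>
  A monomial is encoded as the finite multiset of the indices of its variables, so that
  \<^term>\<open>{#0, 0, 3#}\<close> stands for $x_0^2 x_3$, multiplication of monomials is the sum of
  multisets, and the degree is the size.  A series is its family of coefficients.
\<close>

typedef series = "UNIV :: (nat multiset \<Rightarrow> rat) set"
  morphisms coefficient Series ..

setup_lifting type_definition_series

instantiation series :: comm_ring_1
begin

lift_definition zero_series :: series is "\<lambda>_. 0" .
lift_definition one_series :: series is "\<lambda>M. if M = {#} then 1 else 0" .
lift_definition plus_series :: "series \<Rightarrow> series \<Rightarrow> series" is "\<lambda>f g M. f M + g M" .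
lift_definition minus_series :: "series \<Rightarrow> series \<Rightarrow> series" is "\<lambda>f g M. f M - g M" .
lift_definition uminus_series :: "series \<Rightarrow> series" is "\<lambda>f M. - f M" .
lift_definition times_series :: "series \<Rightarrow> series \<Rightarrow> series"
  is "\<lambda>f g M. \<Sum>(A, B) | A + B = M. f A * g B" .

lemma finite_splittings: "finite {(A, B). A + B = (M :: nat multiset)}"
proof (rule finite_subset)
  show "{(A, B). A + B = M} \<subseteq> {A. A \<subseteq># M} \<times> {A. A \<subseteq># M}" by auto
  have "finite {A. A \<subseteq># M}"
    by (rule finite_subset[of _ "\<Union>n \<le> size M. multisets_of_size (set_mset M) n"])
      (use finite_multisets_of_size[OF finite_set_mset] in
        \<open>auto simp: multisets_of_size_def size_mset_mono dest: mset_subset_eqD\<close>)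
  then show "finite ({A. A \<subseteq># M} \<times> {A. A \<subseteq># M})" by blast
qed

instance
proof
  fix f g h :: series
  show "f + g + h = f + (g + h)" "f + g = g + f" "0 + f = f" "- f + f = 0" "f - g = f + - g"
    by (transfer; force)+
  show "(0 :: series) \<noteq> 1" by transfer (metis zero_neq_one)
  show "f * g = g * f"
  proof (transfer, rule ext)
    fix f g :: "nat multiset \<Rightarrow> rat" and M
    show "(\<Sum>(A, B) | A + B = M. f A * g B) = (\<Sum>(A, B) | A + B = M. g A * f B)"
      by (rule sum.reindex_bij_witness[where i = prod.swap and j = prod.swap])
        (auto simp: add.commute)
  qed
  show "1 * f = f"
  proof (transfer, rule ext)
    fix f :: "nat multiset \<Rightarrow> rat" and M
    have "(\<Sum>(A, B) | A + B = M. (if A = {#} then 1 else 0) * f B)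
        = (\<Sum>(A, B) \<in> {({#} :: nat multiset, M)}. (if A = {#} then 1 else 0) * f B)"
      by (rule sum.mono_neutral_right) (auto simp: finite_splittings split: if_splits)
    then show "(\<Sum>(A, B) | A + B = M. (if A = {#} then 1 else 0) * f B) = f M" by simp
  qed
  show "(f + g) * h = f * h + g * h"
    by transfer (simp add: distrib_right sum.distrib split_beta)
  show "f * g * h = f * (g * h)"
  proof (transfer, rule ext)
    fix f g h :: "nat multiset \<Rightarrow> rat" and M
    have "(\<Sum>(D, C) | D + C = M. (\<Sum>(A, B) | A + B = D. f A * g B) * h C)
        = (\<Sum>(p, q) \<in> Sigma {(D, C). D + C = M} (\<lambda>p. {(A, B). A + B = fst p}).
            f (fst q) * g (snd q) * h (snd p))"
      by (subst sum.Sigma[symmetric])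
        (auto simp: finite_splittings sum_distrib_right split_beta intro!: sum.cong)
    also have "\<dots> = (\<Sum>(p, q) \<in> Sigma {(A, E). A + E = M} (\<lambda>p. {(B, C). B + C = snd p}).
            f (fst p) * (g (fst q) * h (snd q)))"
      by (rule sum.reindex_bij_witness
          [where i = "\<lambda>((A, E), (B, C)). ((A + B, C), (A, B))"
             and j = "\<lambda>((D, C), (A, B)). ((A, B + C), (B, C))"])
        (auto simp: add.assoc mult.assoc)
    also have "\<dots> = (\<Sum>(A, E) | A + E = M. f A * (\<Sum>(B, C) | B + C = E. g B * h C))"
      by (subst sum.Sigma[symmetric])
        (auto simp: finite_splittings sum_distrib_left split_beta intro!: sum.cong)
    finally show "(\<Sum>(D, C) | D + C = M. (\<Sum>(A, B) | A + B = D. f A * g B) * h C)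
        = (\<Sum>(A, E) | A + E = M. f A * (\<Sum>(B, C) | B + C = E. g B * h C))" .
  qed
qed

end

lift_definition qscale :: "rat \<Rightarrow> series \<Rightarrow> series" is "\<lambda>c f M. c * f M" .


section \<open>Partitions and their Young diagrams\<close>

definition is_partition :: "nat list \<Rightarrow> bool" where
  "is_partition \<alpha> \<longleftrightarrow> sorted_wrt (\<ge>) \<alpha> \<and> 0 \<notin> set \<alpha>"

definition partition_of :: "nat \<Rightarrow> nat list \<Rightarrow> bool" where
  "partition_of n \<alpha> \<longleftrightarrow> is_partition \<alpha> \<and> sum_list \<alpha> = n"

definition diagram :: "nat list \<Rightarrow> (nat \<times> nat) set" where
  "diagram \<alpha> = {(i, j). i < length \<alpha> \<and> j < \<alpha> ! i}"

definition corners :: "nat list \<Rightarrow> (nat \<times> nat) set" where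
  "corners \<alpha> = {c \<in> diagram \<alpha>. \<exists>\<gamma>. is_partition \<gamma> \<and> diagram \<gamma> = diagram \<alpha> - {c}}"

definition move_box :: "nat list \<Rightarrow> nat list set" where
  "move_box \<alpha> = {\<beta>. is_partition \<beta> \<and> \<beta> \<noteq> \<alpha> \<and>
     (\<exists>\<gamma>. is_partition \<gamma> \<and>
        (\<exists>c \<in> corners \<alpha>. diagram \<gamma> = diagram \<alpha> - {c}) \<and>
        (\<exists>d. d \<notin> diagram \<gamma> \<and> diagram \<beta> = insert d (diagram \<gamma>)))}"


section \<open>Symmetric functions\<close>

text \<open>Complete homogeneous symmetric functions; $h_0 = 1$ and $h_m = 0$ for $m < 0$.\<close>

lift_definition hsym :: "int \<Rightarrow> series" is "\<lambda>m M. if int (size M) = m then 1 else 0" .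

text \<open>Power sums $p_r = \sum_i x_i^r$, used for $r \geq 1$ only.\<close>

lift_definition psum :: "nat \<Rightarrow> series" is "\<lambda>r M. if \<exists>i. M = replicate_mset r i then 1 else 0" .

definition psum_part :: "nat list \<Rightarrow> series" where
  "psum_part \<mu> = prod_list (map psum \<mu>)"

definition zee :: "nat list \<Rightarrow> rat" where
  "zee \<mu> = (\<Prod>i \<in> set \<mu>. of_nat (i ^ count_list \<mu> i * fact (count_list \<mu> i)))"

text \<open>
  The $p_\lambda$ form a basis of the algebra of symmetric functions over the rationals, so each
  symmetric function determines its coefficients in this basis.
\<close>

definition psum_coeffs :: "series \<Rightarrow> nat list \<Rightarrow> rat" where
  "psum_coeffs f = (THE c. finite {\<mu>. c \<mu> \<noteq> 0} \<and> (\<forall>\<mu>. c \<mu> \<noteq> 0 \<longrightarrow> is_partition \<mu>) \<and>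
     f = (\<Sum>\<mu> | c \<mu> \<noteq> 0. qscale (c \<mu>) (psum_part \<mu>)))"

text \<open>
  The bilinear extension of $p_\lambda \ast p_\mu = \delta_{\lambda\mu} z_\lambda p_\lambda$;
  meaningful for symmetric functions only.
\<close>

definition kronecker :: "series \<Rightarrow> series \<Rightarrow> series" where
  "kronecker f g = (\<Sum>\<mu> | psum_coeffs f \<mu> \<noteq> 0. \<Sum>\<nu> | psum_coeffs g \<nu> \<noteq> 0.
     qscale (psum_coeffs f \<mu> * psum_coeffs g \<nu>)
       (if \<mu> = \<nu> then qscale (zee \<mu>) (psum_part \<mu>) else 0))"


section \<open>Skew Schur functions\<close>

text \<open>
  A tableau is a function on its set of boxes, with the value \<^term>\<open>undefined\<close> elsewhere so
  that distinct tableaux are distinct functions.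
\<close>

definition ssyt :: "(nat \<times> nat) set \<Rightarrow> (nat \<times> nat \<Rightarrow> nat) set" where
  "ssyt D = {T. (\<forall>b. b \<notin> D \<longrightarrow> T b = undefined) \<and>
     (\<forall>i j j'. (i, j) \<in> D \<and> (i, j') \<in> D \<and> j < j' \<longrightarrow> T (i, j) \<le> T (i, j')) \<and>
     (\<forall>i i' j. (i, j) \<in> D \<and> (i', j) \<in> D \<and> i < i' \<longrightarrow> T (i, j) < T (i', j))}"

lift_definition tableau_series :: "(nat \<times> nat) set \<Rightarrow> series"
  is "\<lambda>D M. of_nat (card {T \<in> ssyt D. image_mset T (mset_set D) = M})" .

definition skew_schur :: "nat list \<Rightarrow> nat list \<Rightarrow> series" where
  "skew_schur \<alpha> \<theta> =
     (if diagram \<theta> \<subseteq> diagram \<alpha> then tableau_series (diagram \<alpha> - diagram \<theta>) else 0)"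

definition jacobi_trudi :: "int list \<Rightarrow> series" where
  "jacobi_trudi as =
     det (mat (length as) (length as) (\<lambda>(i, j). hsym (as ! i + int j - int i)))"

definition schur :: "int list \<Rightarrow> series" where
  "schur as =
     (if \<exists>\<alpha>. is_partition \<alpha> \<and> as = map int \<alpha> then skew_schur (map nat as) []
      else jacobi_trudi as)"

end

theory Submission
  imports Defs "HOL-Library.FuncSet"
begin

text \<open>
  Write $m = n - k$.  On symmetric functions of degree $m$ the complete function $h_m$ is the unit of
  the Kronecker product, and $h_{m-1} h_1$ multiplies each $p_\lambda$ by the number of parts of
  $\lambda$ equal to $1$; that is, it acts as $p_1 \, \partial / \partial p_1$.  This is read off from
  $h_m = \sum_\lambda z_\lambda^{-1} p_\lambda$.  Since $s_{(m-1,1)} = h_{m-1} h_1 - h_m$, the product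
  to be computed is $p_1 \cdot \partial s_{\alpha/\theta} / \partial p_1 - s_{\alpha/\theta}$
  (\<open>kronecker_hook\<close>).

  The derivative has a combinatorial meaning.  Separating a variable $x_N$ from the others turns $p_r$
  into $p_r + x_N^r$, so the part linear in $x_N$ comes from the factors $p_1$ only and is the
  derivative by $p_1$: its coefficient at a monomial $M$ without $x_N$ is the coefficient of the
  original function at $x_N M$.  In a tableau that uses $N$ once, with $N$ the
  largest entry, the box of $N$ is a corner of $\alpha$, so the derivative of $s_{\alpha/\theta}$ is
  $\sum_\gamma s_{\gamma/\theta}$ over the $\gamma$ obtained from $\alpha$ by removing a corner.  If
  $N$ were the smallest entry, its box would be added to $\theta$ instead, and by symmetry the two
  descriptions agree (\<open>sum_remove_outer_eq_sum_add_inner\<close>).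

  Multiplication by $p_1$ is described by the skew Pieri rule (\<open>skew_pieri\<close>),
  $p_1 s_{\gamma/\theta} = \sum_\beta s_{\beta/\theta} - \sum_\phi s_{\gamma/\phi}$, where $\beta$
  arises from $\gamma$ by adding a box and $\phi$ from $\theta$ by removing one.  Summed over all
  $\gamma$, the first part is the sum over all ways to remove a box of $\alpha$ and then add one: it
  meets $\alpha$ once per corner and each other partition at most once.  In the second part the sum
  over $\gamma$ is the derivative of $s_{\alpha/\phi}$, which may be rewritten as a sum over boxes
  added to $\phi$; so it is the sum over all ways to remove a box of $\theta$ and then add one.

  All facts on skew Schur functions come from one description of their coefficients.  The boxes with
  entries at most $i$ in a tableau form a growing sequence of shapes, in which each shape differs
  from the next by a horizontal strip (\<open>card_tableaux_eq_chains\<close>).  Shapes are represented by their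
  row lengths, for which being a horizontal strip is an interlacing condition.  Two consecutive
  strips can exchange their sizes by a reflection of the row lengths in the middle
  (\<open>chains_swap\<close>), which gives the symmetry; and adding a strip almost commutes with removing a box
  (\<open>card_strips_above\<close>), which gives the Pieri rule.

  The Kronecker product is defined by power sum expansions, so these have to exist and to be unique
  for symmetric functions.  Both follow from triangularity: among the monomials of $p_\mu$ the ones
  with the most variables have exactly the parts of $\mu$ as exponents
  (\<open>psum_part_nonzero\<close>, \<open>psum_independent\<close>, \<open>symmetric_eq_combination\<close>).
\<close>

section \<open>Shapes and horizontal strips\<close>

text \<open>
  A partition is represented by its row lengths, a weakly decreasing function that is eventually
  zero.  Conditions on neighbouring rows then need no case distinction at the end of the partition.
\<close>

definition shape :: "(nat \<Rightarrow> nat) \<Rightarrow> bool" where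
  "shape f \<longleftrightarrow> decseq f \<and> (\<exists>n. f n = 0)"

definition boxes :: "(nat \<Rightarrow> nat) \<Rightarrow> (nat \<times> nat) set" where
  "boxes f = {(i, j). j < f i}"

text \<open>
  The interlacing condition says that each column gains at most one box.  It transfers
  the shape property from either of the two functions to the other.
\<close>

definition hstrip :: "(nat \<Rightarrow> nat) \<Rightarrow> (nat \<Rightarrow> nat) \<Rightarrow> bool" where
  "hstrip f g \<longleftrightarrow> (\<forall>i. f i \<le> g i \<and> g (Suc i) \<le> f i)"

definition strips :: "nat \<Rightarrow> (nat \<Rightarrow> nat) \<Rightarrow> (nat \<Rightarrow> nat) set" where
  "strips a f = {g. hstrip f g \<and> card (boxes g) = card (boxes f) + a}"

definition add_box :: "(nat \<Rightarrow> nat) \<Rightarrow> (nat \<Rightarrow> nat) set" where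
  "add_box f = {g. shape g \<and> (\<exists>r. g = f(r := Suc (f r)))}"

definition remove_box :: "(nat \<Rightarrow> nat) \<Rightarrow> (nat \<Rightarrow> nat) set" where
  "remove_box g = {f. shape f \<and> (\<exists>r. g = f(r := Suc (f r)))}"

lemma shape_support:
  assumes "shape f"
  obtains L where "\<And>i. L \<le> i \<Longrightarrow> f i = 0"
  using assms unfolding shape_def decseq_def by (metis le_zero_eq)

lemma card_boxes:
  assumes "\<And>i. L \<le> i \<Longrightarrow> f i = 0"
  shows "card (boxes f) = (\<Sum>i<L. f i)"
proof -
  have "boxes f = Sigma {..<L} (\<lambda>i. {..<f i})"
    unfolding boxes_def using assms by (auto simp: not_le[symmetric])
  then show ?thesis by simp
qed

lemma finite_boxes: "shape f \<Longrightarrow> finite (boxes f)"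
proof -
  assume "shape f"
  then obtain L where L: "\<And>i. L \<le> i \<Longrightarrow> f i = 0" by (rule shape_support) blast
  have "boxes f \<subseteq> Sigma {..<L} (\<lambda>i. {..<f i})"
    unfolding boxes_def using L by (auto simp: not_le[symmetric])
  then show ?thesis by (rule finite_subset) auto
qed

lemma boxes_mono_iff: "boxes f \<subseteq> boxes g \<longleftrightarrow> f \<le> g"
proof
  assume *: "boxes f \<subseteq> boxes g"
  show "f \<le> g"
  proof (rule le_funI, rule ccontr)
    fix i assume "\<not> f i \<le> g i"
    then have "(i, g i) \<in> boxes f" "(i, g i) \<notin> boxes g" by (auto simp: boxes_def)
    with * show False by blast
  qed
qed (auto simp: boxes_def le_fun_def intro: less_le_trans)

lemma finite_shapes_below: "shape g \<Longrightarrow> finite {f. f \<le> g}"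
proof -
  assume "shape g"
  then have "finite (boxes ` {f. f \<le> g})"
    by (intro finite_subset[OF _ finite_Pow_iff[THEN iffD2, OF finite_boxes[of g]]])
      (use boxes_mono_iff in blast)+
  moreover have "inj_on boxes {f. f \<le> g}"
    by (rule inj_onI) (metis boxes_mono_iff order_antisym order_refl)
  ultimately show ?thesis by (rule finite_imageD)
qed

lemma hstrip_le: "hstrip f g \<Longrightarrow> f \<le> g"
  by (simp add: hstrip_def le_fun_def)

lemma shape_hstrip:
  assumes "hstrip f g" "shape f" shows "shape g"
proof -
  obtain n where "f n = 0" using assms(2) by (auto simp: shape_def)
  then have "g (Suc n) = 0" using assms(1) by (metis hstrip_def le_zero_eq)
  then have "\<exists>n. g n = 0" by blast
  moreover have "decseq g"
    unfolding decseq_Suc_iff using assms(1) by (meson hstrip_def le_trans)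
  ultimately show ?thesis by (auto simp: shape_def)
qed

lemma shape_hstrip':
  assumes "hstrip f g" "shape g" shows "shape f"
proof -
  obtain n where "g n = 0" using assms(2) by (auto simp: shape_def)
  then have "f n = 0" using assms(1) by (metis hstrip_def le_zero_eq)
  then have "\<exists>n. f n = 0" by blast
  moreover have "decseq f"
    unfolding decseq_Suc_iff using assms(1) by (meson hstrip_def le_trans)
  ultimately show ?thesis by (auto simp: shape_def)
qed

lemma shape_strips: "shape f \<Longrightarrow> g \<in> strips a f \<Longrightarrow> shape g"
  by (auto simp: strips_def intro: shape_hstrip)

lemma card_boxes_upd:
  assumes "shape f"
  shows "card (boxes (f(r := Suc (f r)))) = Suc (card (boxes f))"
proof -
  have "boxes (f(r := Suc (f r))) = insert (r, f r) (boxes f)"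
    by (auto simp: boxes_def split: if_splits)
  then show ?thesis using finite_boxes[OF assms] by (simp add: boxes_def)
qed

lemma card_boxes_mono: "f \<le> g \<Longrightarrow> shape g \<Longrightarrow> card (boxes f) \<le> card (boxes g)"
  by (simp add: boxes_mono_iff card_mono finite_boxes)

lemma card_boxes_eq: "f \<le> g \<Longrightarrow> shape g \<Longrightarrow> card (boxes f) = card (boxes g) \<Longrightarrow> f = g"
  by (metis boxes_mono_iff card_subset_eq finite_boxes order_antisym order_refl)

text \<open>
  A strip of bounded size has a bounded first row, and interlacing bounds every other row.
\<close>

lemma finite_strips: assumes "shape f" shows "finite (strips a f)"
proof -
  \<comment> \<open>An upper bound for all row lengths; cut off after the last nonempty row it becomes a shape.\<close>
  define b where "b i = (case i of 0 \<Rightarrow> card (boxes f) + a | Suc i \<Rightarrow> f i)" for i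
  have "g \<le> b" if "g \<in> strips a f" for g
  proof (rule le_funI)
    fix i
    have g: "hstrip f g" "card (boxes g) = card (boxes f) + a" using that by (auto simp: strips_def)
    have sg: "shape g" using shape_hstrip[OF g(1) assms] .
    show "g i \<le> b i"
    proof (cases i)
      case 0
      have "(\<lambda>j. (0, j)) ` {..<g 0} \<subseteq> boxes g" by (auto simp: boxes_def)
      from card_mono[OF finite_boxes[OF sg] this]
      have "g 0 \<le> card (boxes g)" by (simp add: card_image inj_on_def)
      then show ?thesis using 0 g(2) by (simp add: b_def)
    qed (use g in \<open>auto simp: b_def hstrip_def\<close>)
  qed
  then have sub: "strips a f \<subseteq> {g. g \<le> b}" by blast
  obtain n where n: "f n = 0" using assms by (auto simp: shape_def)
  have "finite {g. g \<le> b}"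
  proof (rule finite_subset)
    define c where "c i = (if i \<le> n then Max (b ` {..n}) else 0)" for i
    have d: "decseq f" using assms by (simp add: shape_def)
    show "{g. g \<le> b} \<subseteq> {g. g \<le> c}"
    proof (safe)
      fix g assume "g \<le> b"
      show "g \<le> c"
      proof (rule le_funI)
        fix i
        have "b i \<le> c i"
        proof (cases "i \<le> n")
          case False
          then obtain k where "i = Suc k" "n \<le> k" by (metis Suc_le_D not_less_eq_eq)
          then show ?thesis using n decseqD[OF d, of n k] by (simp add: b_def)
        qed (simp add: c_def)
        then show "g i \<le> c i" using \<open>g \<le> b\<close> le_funD order_trans by metis
      qed
    qed
    have "shape c" unfolding shape_def decseq_def c_def by (intro conjI exI[of _ "Suc n"]) auto
    then show "finite {g. g \<le> c}" by (rule finite_shapes_below)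
  qed
  with sub show ?thesis by (rule finite_subset)
qed

lemma grown_by_one:
  assumes f: "shape f" and g: "shape g" and fg: "f \<le> g" and cg: "card (boxes g) = Suc (card (boxes f))"
  obtains r where "g = f(r := Suc (f r))"
proof -
  have "f \<noteq> g" using cg by auto
  then obtain r where r: "f r \<noteq> g r" by auto
  then have "f(r := Suc (f r)) \<le> g" using fg by (auto simp: le_fun_def Suc_le_eq intro: le_neq_trans)
  from card_boxes_eq[OF this g] have "f(r := Suc (f r)) = g"
    using card_boxes_upd[OF f] cg by simp
  with that show thesis by metis
qed

text \<open>
  A single new box is a horizontal strip, since the box above it in its column is an old one.
\<close>

lemma add_box_iff_strip:
  assumes "shape f" shows "add_box f = strips 1 f"
proof (rule equalityI; rule subsetI)
  fix g assume "g \<in> add_box f"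
  then obtain r where g: "shape g" "g = f(r := Suc (f r))" by (auto simp: add_box_def)
  have "g (Suc i) \<le> f i" for i
  proof -
    have "g (Suc i) \<le> g i" "f (Suc i) \<le> f i"
      using assms g(1) by (simp_all add: shape_def decseq_Suc_iff)
    then show ?thesis unfolding g(2) by (auto split: if_splits)
  qed
  then show "g \<in> strips 1 f"
    using g card_boxes_upd[OF assms] by (auto simp: strips_def hstrip_def)
next
  fix g assume g: "g \<in> strips 1 f"
  then have sg: "shape g" and fg: "f \<le> g" and cg: "card (boxes g) = Suc (card (boxes f))"
    using shape_strips[OF assms] by (auto simp: strips_def hstrip_le)
  obtain r where "g = f(r := Suc (f r))" by (rule grown_by_one[OF assms sg fg cg])
  then show "g \<in> add_box f" using sg by (auto simp: add_box_def)
qed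

lemma finite_add_box: "shape f \<Longrightarrow> finite (add_box f)"
  by (simp add: add_box_iff_strip finite_strips)

lemma finite_remove_box: "shape f \<Longrightarrow> finite (remove_box f)"
  by (rule finite_subset[OF _ finite_shapes_below[of f]]) (auto simp: remove_box_def le_fun_def)

section \<open>Chains of horizontal strips\<close>

text \<open>
  The sequences counted here encode the semistandard tableaux of skew shape \<open>g\<close> over \<open>f\<close>: the strip
  sizes are the numbers of boxes with entry \<open>0\<close>, \<open>1\<close>, \<open>2\<close> and so on.
\<close>

fun chains :: "nat list \<Rightarrow> (nat \<Rightarrow> nat) \<Rightarrow> (nat \<Rightarrow> nat) \<Rightarrow> nat" where
  "chains [] f g = (if f = g then 1 else 0)"
| "chains (a # as) f g = (\<Sum>e \<in> strips a f. chains as e g)"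

lemma chains_nonzero:
  assumes "chains as f g \<noteq> 0" "shape f"
  shows "f \<le> g \<and> card (boxes g) = card (boxes f) + sum_list as"
  using assms
proof (induction as arbitrary: f)
  case (Cons a as)
  from Cons.prems(1) have "(\<Sum>e \<in> strips a f. chains as e g) \<noteq> 0" unfolding chains.simps .
  then obtain e where e: "e \<in> strips a f" "chains as e g \<noteq> 0"
    by (rule sum.not_neutral_contains_not_neutral)
  have "e \<le> g" "card (boxes g) = card (boxes e) + sum_list as"
    using Cons.IH[OF e(2) shape_strips[OF Cons.prems(2) e(1)]] by auto
  then show ?case using e(1) hstrip_le[of f e] by (auto simp: strips_def)
qed (auto split: if_splits)

text \<open>
  If \<open>f\<close> and \<open>g\<close> are fixed, the shapes \<open>e\<close> that lie between them with both steps horizontal strips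
  are described by an interval for each row separately, and \<open>reflect\<close> mirrors each row length in its
  interval.  This is the Bender--Knuth involution in terms of Gelfand--Tsetlin patterns.
\<close>

definition reflect :: "(nat \<Rightarrow> nat) \<Rightarrow> (nat \<Rightarrow> nat) \<Rightarrow> (nat \<Rightarrow> nat) \<Rightarrow> nat \<Rightarrow> nat" where
  "reflect f g e i = max (f i) (g (Suc i)) + (case i of 0 \<Rightarrow> g 0 | Suc i' \<Rightarrow> min (g i) (f i')) - e i"

lemma between_hstrips:
  assumes "hstrip f e" "hstrip e g"
  shows "max (f i) (g (Suc i)) \<le> e i" "e i \<le> (case i of 0 \<Rightarrow> g 0 | Suc i' \<Rightarrow> min (g i) (f i'))"
proof -
  have h: "f i \<le> e i" "e (Suc i) \<le> f i" "e i \<le> g i" "g (Suc i) \<le> e i" for i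
    using assms by (simp_all add: hstrip_def)
  show "max (f i) (g (Suc i)) \<le> e i" using h by simp
  show "e i \<le> (case i of 0 \<Rightarrow> g 0 | Suc i' \<Rightarrow> min (g i) (f i'))" using h by (cases i) simp_all
qed

lemma reflect_reflect: "hstrip f e \<Longrightarrow> hstrip e g \<Longrightarrow> reflect f g (reflect f g e) = e"
proof
  fix i assume "hstrip f e" "hstrip e g"
  from between_hstrips[OF this, of i] show "reflect f g (reflect f g e) i = e i"
    unfolding reflect_def by linarith
qed

lemma reflect_hstrip:
  assumes "hstrip f e" "hstrip e g"
  shows "hstrip f (reflect f g e)" "hstrip (reflect f g e) g"
proof -
  note b = between_hstrips[OF assms]
  have 1: "max (f i) (g (Suc i)) \<le> reflect f g e i"
    and 2: "reflect f g e i \<le> (case i of 0 \<Rightarrow> g 0 | Suc i' \<Rightarrow> min (g i) (f i'))" for i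
    using b[of i] unfolding reflect_def by linarith+
  have "f i \<le> reflect f g e i" "g (Suc i) \<le> reflect f g e i" "reflect f g e (Suc i) \<le> f i"
    "reflect f g e i \<le> g i" for i
    using 1[of i] 2[of i] 2[of "Suc i"] by (simp_all split: nat.splits)
  then show "hstrip f (reflect f g e)" "hstrip (reflect f g e) g"
    unfolding hstrip_def by blast+
qed

text \<open>
  The end points of all intervals add up to the sizes of \<open>f\<close> and \<open>g\<close>, because \<open>max a b + min a b\<close> is
  \<open>a + b\<close> and the maximum for one row meets the minimum for the next.
\<close>

lemma card_reflect:
  assumes "hstrip f e" "hstrip e g" "shape g"
  shows "card (boxes (reflect f g e)) + card (boxes e) = card (boxes f) + card (boxes g)"
proof -
  obtain L where L: "\<And>i. L \<le> i \<Longrightarrow> g i = 0" using shape_support[OF assms(3)] by blast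
  note fl = reflect_hstrip[OF assms(1,2)]
  have z: "e i = 0" "f i = 0" "reflect f g e i = 0" if "Suc L \<le> i" for i
    using assms fl L[of i] that unfolding hstrip_def by (metis Suc_leD le_zero_eq)+
  \<comment> \<open>Only the maximum for the last row has no partner; it vanishes once \<open>n\<close> is beyond both shapes.\<close>
  have "(\<Sum>i<Suc n. max (f i) (g (Suc i)) + (case i of 0 \<Rightarrow> g 0 | Suc i' \<Rightarrow> min (g i) (f i')))
      = (\<Sum>i<n. f i) + (\<Sum>i<Suc n. g i) + max (f n) (g (Suc n))" for n
    by (induction n) auto
  from this[of L] have "(\<Sum>i<Suc L. max (f i) (g (Suc i)) + (case i of 0 \<Rightarrow> g 0 | Suc i' \<Rightarrow> min (g i) (f i')))
      = (\<Sum>i<Suc L. f i) + (\<Sum>i<Suc L. g i)" using L by simp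
  moreover have "reflect f g e i + e i = max (f i) (g (Suc i)) + (case i of 0 \<Rightarrow> g 0 | Suc i' \<Rightarrow> min (g i) (f i'))" for i
    using between_hstrips[OF assms(1,2), of i] unfolding reflect_def by linarith
  ultimately show ?thesis
    using card_boxes[of "Suc L"] z L by (simp add: sum.distrib[symmetric] del: sum.lessThan_Suc)
qed

text \<open>
  Reflecting the shape between two consecutive strips exchanges the sizes of these strips.
\<close>

lemma chains_swap:
  assumes "shape f" shows "chains (a # b # as) f g = chains (b # a # as) f g"
proof -
  have *: "chains (a # b # as) f g
     = (\<Sum>(e, h) \<in> Sigma (strips a f) (strips b). chains as h g)" for a b
    by (simp add: sum.Sigma finite_strips assms shape_strips[OF assms])
  have reflect: "reflect f h e \<in> strips b f" "h \<in> strips a (reflect f h e)" "reflect f h (reflect f h e) = e"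
    if "e \<in> strips a f" "h \<in> strips b e" for a b e h
  proof -
    have s: "hstrip f e" "hstrip e h" "shape h"
      using that shape_strips[OF shape_strips[OF assms that(1)] that(2)] by (auto simp: strips_def)
    show "reflect f h (reflect f h e) = e" using reflect_reflect s by blast
    show "reflect f h e \<in> strips b f" "h \<in> strips a (reflect f h e)"
      using reflect_hstrip[OF s(1,2)] card_reflect[OF s] that by (auto simp: strips_def)
  qed
  show ?thesis unfolding *
    by (rule sum.reindex_bij_witness[where i = "\<lambda>(e, h). (reflect f h e, h)" and j = "\<lambda>(e, h). (reflect f h e, h)"])
      (auto simp: reflect)
qed

lemma chains_move: "shape f \<Longrightarrow> chains (us @ a # vs) f g = chains (a # us @ vs) f g"
proof (induction us arbitrary: f)
  case (Cons u us)
  have "chains ((u # us) @ a # vs) f g = chains (u # a # us @ vs) f g"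
    using Cons.IH[OF shape_strips[OF Cons.prems]] by simp
  then show ?case using chains_swap[OF Cons.prems] by simp
qed simp

lemma chains_perm: "shape f \<Longrightarrow> mset as = mset bs \<Longrightarrow> chains as f g = chains bs f g"
proof (induction as arbitrary: bs f)
  case (Cons a as)
  then have "a \<in> set bs" by (metis list.set_intros(1) set_mset_mset)
  then obtain us vs where bs: "bs = us @ a # vs" by (meson split_list)
  have "chains as e g = chains (us @ vs) e g" if "e \<in> strips a f" for e
    using Cons.prems bs by (intro Cons.IH shape_strips[OF Cons.prems(1) that]) auto
  then show ?case unfolding bs chains_move[OF Cons.prems(1)] by simp
qed simp

text \<open>
  Describes the tableaux whose largest entry occurs once, by the shape that remains without it.
\<close>

lemma chains_snoc_one:
  assumes "shape f" "shape g"
  shows "chains (as @ [1]) f g = (\<Sum>e \<in> remove_box g. chains as f e)"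
  using assms(1)
proof (induction as arbitrary: f)
  case Nil
  have "f \<in> remove_box g \<longleftrightarrow> g \<in> strips 1 f"
    unfolding add_box_iff_strip[OF Nil, symmetric] using Nil assms(2) by (auto simp: add_box_def remove_box_def)
  then show ?case using Nil finite_strips finite_remove_box[OF assms(2)]
    by (simp add: sum.delta' if_distrib[where f = of_nat] finite_strips cong: if_cong)
next
  case (Cons a as)
  have "chains ((a # as) @ [1]) f g = (\<Sum>h \<in> strips a f. \<Sum>e \<in> remove_box g. chains as h e)"
    using Cons.IH[OF shape_strips[OF Cons.prems]] by simp
  then show ?case by (subst (asm) sum.swap) simp
qed

section \<open>Adding strips and removing boxes\<close>

text \<open>
  If \<open>f\<close> and \<open>g\<close> interlace, then row \<open>r + 1\<close> of \<open>g\<close> can grow exactly when row \<open>r\<close> of \<open>f\<close> can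
  shrink, and in addition row \<open>0\<close> of \<open>g\<close> can always grow.  If they do not interlace, both operations
  have to repair the same defect, a single row in which \<open>f\<close> exceeds \<open>g\<close> by one box.
\<close>

lemma card_grow_strip_eq_card_shrink:
  assumes "shape f" "shape g"
  shows "card {r. hstrip f (g(r := Suc (g r)))}
       = card {r. f r > 0 \<and> hstrip (f(r := f r - 1)) g} + of_bool (hstrip f g)"
proof (cases "hstrip f g")
  case True
  then have h: "f i \<le> g i" "g (Suc i) \<le> f i" for i by (simp_all add: hstrip_def)
  have d: "f (Suc i) \<le> f i" "g (Suc i) \<le> g i" for i
    using assms by (simp_all add: shape_def decseq_Suc_iff)
  \<comment> \<open>Row \<open>0\<close> of \<open>g\<close> has no upper bound; row \<open>r + 1\<close> is bounded by row \<open>r\<close> of \<open>f\<close>.\<close>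
  have 1: "{r. hstrip f (g(r := Suc (g r)))} = insert 0 (Suc ` {r. g (Suc r) < f r})" (is "?L = ?R")
  proof (intro equalityI subsetI)
    fix r assume "r \<in> ?L"
    then show "r \<in> ?R" by (cases r) (auto simp: hstrip_def dest: spec[of _ "r - 1"])
  next
    fix r assume "r \<in> ?R"
    then show "r \<in> ?L" using h by (auto simp: hstrip_def le_SucI Suc_le_eq)
  qed
  have 2: "{r. f r > 0 \<and> hstrip (f(r := f r - 1)) g} = {r. g (Suc r) < f r}" (is "?L = ?R")
  proof (intro equalityI subsetI)
    fix r assume "r \<in> ?L"
    then have "f r > 0" "g (Suc r) \<le> f r - 1" by (auto simp: hstrip_def dest: spec[of _ r])
    then show "r \<in> ?R" by auto
  next
    fix r assume "r \<in> ?R"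
    then have r: "g (Suc r) < f r" by simp
    have "f i - 1 \<le> g i" for i using h(1)[of i] by linarith
    moreover have "g (Suc r) \<le> f r - 1" using r by linarith
    ultimately show "r \<in> ?L" using h r by (auto simp: hstrip_def)
  qed
  obtain L where "\<And>i. L \<le> i \<Longrightarrow> f i = 0" using shape_support[OF assms(1)] by blast
  then have "{r. g (Suc r) < f r} \<subseteq> {..<L}" by (auto simp: not_le[symmetric])
  then have "finite {r. g (Suc r) < f r}" using finite_subset by blast
  then show ?thesis unfolding 1 2 using True by (simp add: card_image)
next
  case False
  have "hstrip f (g(r := Suc (g r))) \<longleftrightarrow> f r > 0 \<and> hstrip (f(r := f r - 1)) g" for r
  proof
    assume *: "hstrip f (g(r := Suc (g r)))"
    then have a: "f i \<le> (g(r := Suc (g r))) i" "(g(r := Suc (g r))) (Suc i) \<le> f i" for i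
      by (simp_all add: hstrip_def)
    have b: "g (Suc i) \<le> f i" for i using a(2)[of i] by (cases "Suc i = r") auto
    have c: "f i \<le> g i" if "i \<noteq> r" for i using a(1)[of i] that by simp
    have fr: "f r = Suc (g r)"
    proof (rule ccontr)
      assume "f r \<noteq> Suc (g r)"
      then have "f r \<le> g r" using a(1)[of r] by simp
      with b c have "hstrip f g" unfolding hstrip_def by metis
      with False show False ..
    qed
    have "g (Suc r) \<le> g r" using assms by (simp add: shape_def decseq_Suc_iff)
    with b c fr show "f r > 0 \<and> hstrip (f(r := f r - 1)) g" by (auto simp: hstrip_def)
  next
    assume *: "f r > 0 \<and> hstrip (f(r := f r - 1)) g"
    then have a: "(f(r := f r - 1)) i \<le> g i" "g (Suc i) \<le> (f(r := f r - 1)) i" for i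
      by (simp_all add: hstrip_def)
    have b: "g (Suc i) \<le> f i" for i using a(2)[of i] by (cases "i = r") auto
    have c: "f i \<le> g i" if "i \<noteq> r" for i using a(1)[of i] that by simp
    have fr: "f r = Suc (g r)"
    proof (rule ccontr)
      assume "f r \<noteq> Suc (g r)"
      then have "f r \<le> g r" using a(1)[of r] * by simp
      with b c have "hstrip f g" unfolding hstrip_def by metis
      with False show False ..
    qed
    have "f (Suc i) \<le> f i" for i using assms by (simp add: shape_def decseq_Suc_iff)
    with b c fr show "hstrip f (g(r := Suc (g r)))" by (auto simp: hstrip_def) (metis)
  qed
  then show ?thesis using False by simp
qed

text \<open>
  The count of rows, restated for shapes: as operators, removing a box and adding a strip of size
  \<open>a\<close> commute up to adding a strip of size \<open>a - 1\<close>.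
\<close>

lemma card_strips_above:
  assumes f: "shape f" and g: "shape g"
  shows "card {e \<in> strips a f. g \<in> remove_box e}
       = card {e \<in> remove_box f. g \<in> strips a e} + of_bool (a > 0 \<and> g \<in> strips (a - 1) f)"
proof (cases "card (boxes g) + 1 = card (boxes f) + a")
  case True
  have 1: "{e \<in> strips a f. g \<in> remove_box e}
      = (\<lambda>r. g(r := Suc (g r))) ` {r. hstrip f (g(r := Suc (g r)))}"
    using True card_boxes_upd[OF g] g by (auto simp: strips_def remove_box_def)
  have 2: "{e \<in> remove_box f. g \<in> strips a e}
      = (\<lambda>r. f(r := f r - 1)) ` {r. f r > 0 \<and> hstrip (f(r := f r - 1)) g}" (is "?L = ?R")
  proof (intro equalityI subsetI)
    fix e assume "e \<in> ?L"
    then obtain r where r: "f = e(r := Suc (e r))" "hstrip e g" by (auto simp: strips_def remove_box_def)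
    then have "e = f(r := f r - 1)" "f r > 0" by auto
    with r(2) show "e \<in> ?R" by blast
  next
    fix e assume "e \<in> ?R"
    then obtain r where r: "e = f(r := f r - 1)" "f r > 0" "hstrip e g" by blast
    then have fe: "f = e(r := Suc (e r))" by auto
    have "shape e" using shape_hstrip'[OF r(3) g] .
    moreover have "card (boxes f) = Suc (card (boxes e))"
      using card_boxes_upd[OF \<open>shape e\<close>, of r] fe by simp
    ultimately show "e \<in> ?L" using fe r(3) True by (auto simp: strips_def remove_box_def)
  qed
  have i1: "inj (\<lambda>r. g(r := Suc (g r)))" by (rule injI) (metis fun_upd_apply n_not_Suc_n)
  have i2: "inj_on (\<lambda>r. f(r := f r - 1)) {r. f r > 0 \<and> hstrip (f(r := f r - 1)) g}"
    by (rule inj_onI) (metis (no_types, lifting) diff_less fun_upd_apply less_numeral_extra(1) mem_Collect_eq nat_less_le)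
  have 3: "a > 0 \<and> g \<in> strips (a - 1) f \<longleftrightarrow> hstrip f g"
    using True card_boxes_mono[OF hstrip_le g, of f] by (auto simp: strips_def)
  show ?thesis
    unfolding 1 2 3 card_image[OF i2] card_image[OF inj_on_subset[OF i1 subset_UNIV]]
    by (rule card_grow_strip_eq_card_shrink[OF f g])
next
  case False
  have "{e \<in> strips a f. g \<in> remove_box e} = {}"
    using False card_boxes_upd[OF g] by (auto simp: strips_def remove_box_def)
  moreover have "{e \<in> remove_box f. g \<in> strips a e} = {}"
    using False card_boxes_upd by (fastforce simp: strips_def remove_box_def)
  moreover have "\<not> (a > 0 \<and> g \<in> strips (a - 1) f)" using False by (auto simp: strips_def)
  ultimately show ?thesis by (simp only: card.empty) simp
qed

lemma shape_remove_box: "e \<in> remove_box f \<Longrightarrow> shape e"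
  by (simp add: remove_box_def)

lemma sum_remove_box_strips:
  fixes G :: "(nat \<Rightarrow> nat) \<Rightarrow> nat"
  assumes f: "shape f"
  shows "(\<Sum>e \<in> strips a f. \<Sum>g \<in> remove_box e. G g)
       = (\<Sum>e \<in> remove_box f. \<Sum>g \<in> strips a e. G g)
         + (if a > 0 then \<Sum>g \<in> strips (a - 1) f. G g else 0)"
proof -
  \<comment> \<open>A finite set of shapes containing every shape that occurs on either side, over which the
    summations can be interchanged.\<close>
  define Z where "Z = (\<Union>e \<in> strips a f. remove_box e) \<union> (\<Union>e \<in> remove_box f. strips a e) \<union> strips (a - 1) f"
  have fin: "finite Z" unfolding Z_def using f
    by (auto intro!: finite_strips finite_remove_box intro: shape_strips shape_remove_box)
  have sh: "shape g" if "g \<in> Z" for g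
    using that f unfolding Z_def by (auto intro: shape_strips shape_remove_box)
  have "(\<Sum>e \<in> strips a f. \<Sum>g \<in> remove_box e. G g)
      = (\<Sum>e \<in> strips a f. \<Sum>g \<in> {g \<in> Z. g \<in> remove_box e}. G g)"
    by (intro sum.cong refl) (auto simp: Z_def)
  also have "\<dots> = (\<Sum>g \<in> Z. card {e \<in> strips a f. g \<in> remove_box e} * G g)"
    by (subst sum.swap_restrict) (simp_all add: fin finite_strips f)
  also have "\<dots> = (\<Sum>g \<in> Z. card {e \<in> remove_box f. g \<in> strips a e} * G g)
      + (\<Sum>g \<in> Z. of_bool (a > 0 \<and> g \<in> strips (a - 1) f) * G g)"
    by (simp add: card_strips_above f sh distrib_right sum.distrib)
  also have "(\<Sum>g \<in> Z. card {e \<in> remove_box f. g \<in> strips a e} * G g)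
      = (\<Sum>e \<in> remove_box f. \<Sum>g \<in> {g \<in> Z. g \<in> strips a e}. G g)"
    by (subst sum.swap_restrict) (simp_all add: fin finite_remove_box f)
  also have "\<dots> = (\<Sum>e \<in> remove_box f. \<Sum>g \<in> strips a e. G g)"
    by (intro sum.cong refl) (auto simp: Z_def)
  also have "(\<Sum>g \<in> Z. of_bool (a > 0 \<and> g \<in> strips (a - 1) f) * G g)
      = (if a > 0 then \<Sum>g \<in> strips (a - 1) f. G g else 0)"
  proof (cases "a > 0")
    case True
    have "Z \<inter> strips (a - 1) f = strips (a - 1) f" by (auto simp: Z_def)
    with True show ?thesis using fin by (simp add: of_bool_def sum.inter_restrict[symmetric] if_distrib[where f = "\<lambda>x. x * _"] cong: if_cong)
  qed simp
  finally show ?thesis .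
qed

text \<open>
  Moving the removal of a box through all strips of a chain produces one correction term for each
  strip, in which this strip has lost a box.
\<close>

lemma chains_pieri:
  assumes "shape f" "shape g"
  shows "(\<Sum>h \<in> add_box g. chains as f h)
       = (\<Sum>e \<in> remove_box f. chains as e g)
         + (\<Sum>i<length as. if as ! i > 0 then chains (as[i := as ! i - 1]) f g else 0)"
  using assms(1)
proof (induction as arbitrary: f)
  case Nil
  have "f \<in> add_box g \<longleftrightarrow> g \<in> remove_box f"
    using Nil assms(2) by (auto simp: add_box_def remove_box_def)
  moreover have "(\<Sum>e \<in> remove_box f. chains [] e g) = (\<Sum>e \<in> remove_box f. if e = g then 1 else 0)"
    "(\<Sum>h \<in> add_box g. chains [] f h) = (\<Sum>h \<in> add_box g. if h = f then 1 else 0)"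
    by (auto intro!: sum.cong)
  ultimately show ?case
    using finite_add_box[OF assms(2)] finite_remove_box[OF Nil] by simp
next
  case (Cons a as)
  let ?c = "\<lambda>f. \<Sum>i<length as. if as ! i > 0 then chains (as[i := as ! i - 1]) f g else 0"
  have "(\<Sum>h \<in> add_box g. chains (a # as) f h) = (\<Sum>e \<in> strips a f. \<Sum>h \<in> add_box g. chains as e h)"
    unfolding chains.simps by (rule sum.swap)
  also have "\<dots> = (\<Sum>e \<in> strips a f. (\<Sum>e' \<in> remove_box e. chains as e' g) + ?c e)"
    by (intro sum.cong refl Cons.IH shape_strips[OF Cons.prems])
  also have "\<dots> = (\<Sum>e \<in> remove_box f. chains (a # as) e g)
      + (if a > 0 then chains ((a - 1) # as) f g else 0) + (\<Sum>e \<in> strips a f. ?c e)"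
    by (simp add: sum.distrib sum_remove_box_strips[OF Cons.prems])
  also have "(\<Sum>e \<in> strips a f. ?c e)
      = (\<Sum>i<length as. if as ! i > 0 then chains (a # as[i := as ! i - 1]) f g else 0)"
    by (subst sum.swap) (auto intro!: sum.cong)
  finally show ?case by (simp only: length_Cons sum.lessThan_Suc_shift) (simp add: o_def cong: if_cong)
qed

section \<open>Tableaux as chains\<close>

definition tableaux :: "(nat \<times> nat) set \<Rightarrow> nat multiset \<Rightarrow> (nat \<times> nat \<Rightarrow> nat) set" where
  "tableaux D M = {T \<in> ssyt D. image_mset T (mset_set D) = M}"

lemma ssyt_undefined: "T \<in> ssyt D \<Longrightarrow> b \<notin> D \<Longrightarrow> T b = undefined"
  by (cases b) (simp add: ssyt_def)

lemma tableaux_entry: "finite D \<Longrightarrow> T \<in> tableaux D M \<Longrightarrow> b \<in> D \<Longrightarrow> T b \<in># M"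
  by (auto simp: tableaux_def)

lemma finite_tableaux: assumes "finite D" shows "finite (tableaux D M)"
proof (rule finite_subset)
  show "tableaux D M \<subseteq> PiE D (\<lambda>_. set_mset M)"
    using tableaux_entry[OF assms] by (auto simp: PiE_def extensional_def) (auto simp: tableaux_def ssyt_def)
  show "finite (PiE D (\<lambda>_. set_mset M))" using assms by (intro finite_PiE) auto
qed

text \<open>
  Turns a region of boxes that is described by the entries of a tableau into a row length function.
\<close>

lemma boxes_row_lengths:
  assumes "finite B" "\<And>i j j'. (i, j) \<in> B \<Longrightarrow> j' < j \<Longrightarrow> (i, j') \<in> B"
  shows "boxes (\<lambda>i. card {j. (i, j) \<in> B}) = B"
proof -
  have "{j. (i, j) \<in> B} = {..<card {j. (i, j) \<in> B}}" for i
  proof -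
    have fin: "finite {j. (i, j) \<in> B}"
      by (rule finite_subset[of _ "snd ` B"]) (use assms(1) in force)+
    define n where "n = (LEAST n. n \<notin> {j. (i, j) \<in> B})"
    have "\<exists>n. n \<notin> {j. (i, j) \<in> B}" using ex_new_if_finite[OF infinite_UNIV_nat fin] by blast
    then have n: "n \<notin> {j. (i, j) \<in> B}" unfolding n_def by (rule LeastI_ex)
    have "{j. (i, j) \<in> B} = {..<n}"
    proof (intro equalityI subsetI)
      fix j assume "j \<in> {j. (i, j) \<in> B}"
      then have "(i, j) \<in> B" by simp
      then show "j \<in> {..<n}" using n assms(2)[of i j n] by (metis lessThan_iff linorder_neqE_nat mem_Collect_eq)
    next
      fix j assume "j \<in> {..<n}"
      then show "j \<in> {j. (i, j) \<in> B}" using not_less_Least[of j "\<lambda>n. n \<notin> {j. (i, j) \<in> B}"] by (auto simp: n_def)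
    qed
    then show ?thesis by simp
  qed
  then show ?thesis unfolding boxes_def by auto
qed

lemma row_lengths_boxes: "(\<lambda>i. card {j. (i, j) \<in> boxes f}) = f"
  by (simp add: boxes_def lessThan_def[symmetric])

text \<open>
  The inner shape enlarged by the boxes of a tableau that contain \<open>k\<close>, for \<open>k\<close> a lower bound
  of the entries.
\<close>

definition least_entry_shape :: "nat \<Rightarrow> (nat \<Rightarrow> nat) \<Rightarrow> (nat \<Rightarrow> nat) \<Rightarrow> (nat \<times> nat \<Rightarrow> nat) \<Rightarrow> nat \<Rightarrow> nat" where
  "least_entry_shape k f g T = (\<lambda>i. card {j. (i, j) \<in> boxes f \<union> {b \<in> boxes g - boxes f. T b = k}})"

lemma boxes_least_entry_shape:
  assumes f: "shape f" and g: "shape g"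
    and T: "T \<in> ssyt (boxes g - boxes f)" and k: "\<forall>b \<in> boxes g - boxes f. k \<le> T b"
  shows "boxes (least_entry_shape k f g T) = boxes f \<union> {b \<in> boxes g - boxes f. T b = k}"
  unfolding least_entry_shape_def
proof (rule boxes_row_lengths)
  show "finite (boxes f \<union> {b \<in> boxes g - boxes f. T b = k})" using finite_boxes f g by auto
  fix i j j' assume ij: "(i, j) \<in> boxes f \<union> {b \<in> boxes g - boxes f. T b = k}" and "j' < j"
  show "(i, j') \<in> boxes f \<union> {b \<in> boxes g - boxes f. T b = k}"
  proof (cases "(i, j') \<in> boxes f")
    case False
    then have D: "(i, j) \<in> boxes g - boxes f" "T (i, j) = k" "(i, j') \<in> boxes g - boxes f"
      using ij \<open>j' < j\<close> by (auto simp: boxes_def)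
    then have "T (i, j') \<le> T (i, j)" using T \<open>j' < j\<close> unfolding ssyt_def by blast
    with bspec[OF k D(3)] D show ?thesis by simp
  qed simp
qed

text \<open>
  Two boxes in a column cannot both contain \<open>k\<close>, because the entries increase strictly downwards.
\<close>

lemma hstrip_least_entry_shape:
  assumes f: "shape f" and g: "shape g" 
    and T: "T \<in> ssyt (boxes g - boxes f)" and k: "\<forall>b \<in> boxes g - boxes f. k \<le> T b"
  shows "hstrip f (least_entry_shape k f g T)"
proof -
  let ?h = "least_entry_shape k f g T"
  note bx = boxes_least_entry_shape[OF assms]
  have "f \<le> ?h" unfolding boxes_mono_iff[symmetric] bx by blast
  moreover have "?h (Suc i) \<le> f i" for i
  proof (rule ccontr)
    assume "\<not> ?h (Suc i) \<le> f i"
    moreover have "f (Suc i) \<le> f i" "g (Suc i) \<le> g i" using f g by (simp_all add: shape_def decseq_Suc_iff)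
    ultimately have "(Suc i, f i) \<in> boxes ?h" "(Suc i, f i) \<notin> boxes f" by (auto simp: boxes_def)
    then have 1: "(Suc i, f i) \<in> boxes g - boxes f" "T (Suc i, f i) = k" unfolding bx by auto
    then have 2: "(i, f i) \<in> boxes g - boxes f" using \<open>g (Suc i) \<le> g i\<close> by (auto simp: boxes_def)
    with 1 T have "T (i, f i) < T (Suc i, f i)" unfolding ssyt_def by blast
    with bspec[OF k 2] 1 show False by simp
  qed
  ultimately show ?thesis by (auto simp: hstrip_def le_fun_def)
qed

lemma tableaux_split_content:
  fixes k :: nat
  assumes "finite K" "finite D" "K \<inter> D = {}" "\<And>b. b \<in> K \<Longrightarrow> T b = k" "\<And>x. x \<in># M \<Longrightarrow> k < x"
    and D: "\<And>b. b \<in> D \<Longrightarrow> T b \<noteq> k"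
  shows "image_mset T (mset_set (K \<union> D)) = replicate_mset a k + M
     \<longleftrightarrow> card K = a \<and> image_mset T (mset_set D) = M"
proof -
  have "image_mset T (mset_set K) = image_mset (\<lambda>_. k) (mset_set K)"
    using assms by (intro image_mset_cong) auto
  then have 1: "image_mset T (mset_set (K \<union> D)) = replicate_mset (card K) k + image_mset T (mset_set D)"
    using assms(1-3) by (simp add: mset_set_Union image_mset_const_eq)
  have "count M k = 0" using assms(5)[of k] by (auto simp: count_eq_zero_iff)
  moreover have "count (image_mset T (mset_set D)) k = 0"
    using D assms(2) by (auto simp: count_eq_zero_iff)
  ultimately have "card K = a" if "replicate_mset (card K) k + image_mset T (mset_set D) = replicate_mset a k + M"
    using arg_cong[OF that, of "\<lambda>X. count X k"] by simp
  then show ?thesis unfolding 1 by auto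
qed

text \<open>
  Cutting off the boxes with the smallest entry \<open>k\<close> leaves a tableau on a smaller skew shape, and
  the cut-off boxes form a horizontal strip; conversely every such strip may be filled with \<open>k\<close>.
\<close>

lemma card_tableaux_peel:
  assumes f: "shape f" and g: "shape g" and fg: "f \<le> g" and M: "\<And>x. x \<in># M \<Longrightarrow> k < x"
  shows "card (tableaux (boxes g - boxes f) (replicate_mset a k + M))
       = (\<Sum>h \<in> strips a f. if h \<le> g then card (tableaux (boxes g - boxes h) M) else 0)"
proof -
  let ?D = "\<lambda>h. boxes g - boxes h"
  let ?S = "Sigma {h \<in> strips a f. h \<le> g} (\<lambda>h. tableaux (?D h) M)"
  define j where "j T = (least_entry_shape k f g T, restrict T (?D (least_entry_shape k f g T)))" for T
  define i where "i = (\<lambda>(h, T) b. if b \<in> boxes h - boxes f then k else T b :: nat)"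
  have fin: "finite (?D h)" for h using finite_boxes[OF g] by blast
  have split: "image_mset T (mset_set (?D f)) = replicate_mset a k + M
      \<longleftrightarrow> h \<in> strips a f \<and> image_mset T (mset_set (?D h)) = M"
    if "hstrip f h" "h \<le> g" "\<And>b. b \<in> boxes h - boxes f \<Longrightarrow> T b = k" "\<And>b. b \<in> ?D h \<Longrightarrow> T b \<noteq> k" for h T
  proof -
    have sub: "boxes f \<subseteq> boxes h" "boxes h \<subseteq> boxes g" using hstrip_le[OF that(1)] that(2) by (simp_all add: boxes_mono_iff)
    have D: "?D f = (boxes h - boxes f) \<union> ?D h" using sub by blast
    have finh: "finite (boxes h)" using finite_boxes[OF shape_hstrip[OF that(1) f]] .
    have finf: "finite (boxes f)" using finite_boxes[OF f] .
    have le: "card (boxes f) \<le> card (boxes h)" using card_mono[OF finh sub(1)] .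
    have "card (boxes h - boxes f) = card (boxes h) - card (boxes f)"
      using card_Diff_subset[OF finf sub(1)] .
    then have c: "card (boxes h - boxes f) = a \<longleftrightarrow> h \<in> strips a f"
      using that(1) le by (auto simp: strips_def)
    show ?thesis unfolding D c[symmetric]
      by (rule tableaux_split_content) (use finh fin that M in auto)
  qed
  have "bij_betw j (tableaux (?D f) (replicate_mset a k + M)) ?S"
  proof (rule bij_betw_byWitness[where f' = i])
    have *: "j T \<in> ?S \<and> i (j T) = T" if T: "T \<in> tableaux (?D f) (replicate_mset a k + M)" for T
    proof -
      let ?h = "least_entry_shape k f g T"
      have ge: "\<forall>b \<in> ?D f. k \<le> T b"
        using tableaux_entry[OF fin T] M by (fastforce simp: in_replicate_mset split: if_splits)
      have ssyt: "T \<in> ssyt (?D f)" and content: "image_mset T (mset_set (?D f)) = replicate_mset a k + M"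
        using T by (auto simp: tableaux_def)
      note bx = boxes_least_entry_shape[OF f g ssyt ge]
      have hs: "hstrip f ?h" by (rule hstrip_least_entry_shape[OF f g ssyt ge])
      have hg: "?h \<le> g" using fg unfolding boxes_mono_iff[symmetric] bx by blast
      have "?h \<in> strips a f \<and> image_mset T (mset_set (?D ?h)) = M"
        using split[OF hs hg, of T] content unfolding bx by blast
      moreover have "image_mset (restrict T (?D ?h)) (mset_set (?D ?h)) = image_mset T (mset_set (?D ?h))"
        using fin by (intro image_mset_cong) auto
      moreover have "restrict T (?D ?h) \<in> ssyt (?D ?h)"
      proof -
        have "?D ?h \<subseteq> ?D f" unfolding bx by blast
        with ssyt show ?thesis unfolding ssyt_def by (auto simp: subset_iff)
      qed
      moreover have "i (j T) = T"
      proof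
        fix b
        have mem: "b \<in> boxes ?h \<longleftrightarrow> b \<in> boxes f \<or> b \<in> boxes g - boxes f \<and> T b = k"
          by (subst bx) blast
        show "i (j T) b = T b"
          unfolding i_def j_def prod.case restrict_def Diff_iff mem
          using ssyt_undefined[OF ssyt, of b] by (cases "b \<in> boxes f"; cases "b \<in> boxes g") auto
      qed
      ultimately show ?thesis using hg by (auto simp: j_def tableaux_def)
    qed
    show "\<forall>T \<in> tableaux (?D f) (replicate_mset a k + M). i (j T) = T"
      "j ` tableaux (?D f) (replicate_mset a k + M) \<subseteq> ?S" using * by blast+
    have **: "i (h, T) \<in> tableaux (?D f) (replicate_mset a k + M) \<and> j (i (h, T)) = (h, T)"
      if h: "h \<in> strips a f" "h \<le> g" and T: "T \<in> tableaux (?D h) M" for h T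
    proof -
      have hs: "hstrip f h" using h by (simp add: strips_def)
      have fh: "boxes f \<subseteq> boxes h" and hg: "boxes h \<subseteq> boxes g"
        using hstrip_le[OF hs] h by (simp_all add: boxes_mono_iff)
      have gt: "k < T b" if "b \<in> ?D h" for b using tableaux_entry[OF fin T that] M by blast
      have ssyt: "T \<in> ssyt (?D h)" and content: "image_mset T (mset_set (?D h)) = M"
        using T by (auto simp: tableaux_def)
      let ?T = "i (h, T)"
      have T1: "?T b = k" if "b \<in> boxes h - boxes f" for b using that by (simp add: i_def)
      have T2: "?T b = T b" if "b \<notin> boxes h - boxes f" for b using that by (auto simp: i_def)
      have hd: "h i' \<le> h i" if "i \<le> i'" for i i'
        using shape_strips[OF f h(1)] that by (simp add: shape_def decseqD)
      have low: "h i' \<le> f i" if "i < i'" for i i'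
        using hd[of "Suc i" i'] hs that unfolding hstrip_def by (meson Suc_leI le_trans)
      have "?T \<in> ssyt (?D f)"
        unfolding ssyt_def
      proof (intro CollectI conjI allI impI; (elim conjE DiffE)?)
        fix b assume "b \<notin> ?D f"
        then have "b \<notin> ?D h" "b \<notin> boxes h - boxes f" using fh hg by auto
        then show "?T b = undefined" using ssyt_undefined[OF ssyt] T2 by simp
      next
        fix r c c' assume b: "(r, c) \<in> boxes g" "(r, c) \<notin> boxes f" "(r, c') \<in> boxes g" "(r, c') \<notin> boxes f" "c < c'"
        show "?T (r, c) \<le> ?T (r, c')"
        proof (cases "(r, c') \<in> boxes h")
          case True
          then have "(r, c) \<in> boxes h" using b(5) by (auto simp: boxes_def)
          with True b show ?thesis by (simp add: T1)
        next
          case F: False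
          show ?thesis
          proof (cases "(r, c) \<in> boxes h")
            case True
            with F b gt[of "(r, c')"] show ?thesis by (simp add: T1 T2)
          next
            case False
            with F b ssyt show ?thesis by (simp add: T2) (auto simp: ssyt_def)
          qed
        qed
      next
        fix r r' c assume b: "(r, c) \<in> boxes g" "(r, c) \<notin> boxes f" "(r', c) \<in> boxes g" "(r', c) \<notin> boxes f" "r < r'"
        have F: "(r', c) \<notin> boxes h" using b low[OF b(5)] by (auto simp: boxes_def)
        show "?T (r, c) < ?T (r', c)"
        proof (cases "(r, c) \<in> boxes h")
          case True
          with F b gt[of "(r', c)"] show ?thesis by (simp add: T1 T2)
        next
          case False
          with F b ssyt show ?thesis by (simp add: T2) (auto simp: ssyt_def)
        qed
      qed
      moreover have gt': "?T b \<noteq> k" if "b \<in> ?D h" for b using gt[OF that] that by (simp add: T2)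
      moreover have "image_mset ?T (mset_set (?D h)) = M"
        unfolding content[symmetric] by (rule image_mset_cong) (use fin T2 in auto)
      ultimately have "?T \<in> tableaux (?D f) (replicate_mset a k + M)"
        using split[OF hs h(2), of ?T] h(1) T1 unfolding tableaux_def by blast
      moreover have "boxes f \<union> {b \<in> ?D f. ?T b = k} = boxes h"
        using fh hg gt' T1 by auto
      then have "least_entry_shape k f g ?T = h"
        unfolding least_entry_shape_def using row_lengths_boxes[of h] by simp
      moreover have "restrict ?T (?D h) = T"
      proof
        fix b show "restrict ?T (?D h) b = T b" using ssyt_undefined[OF ssyt, of b] T2[of b] by (auto simp: restrict_def)
      qed
      ultimately show ?thesis by (simp add: j_def)
    qed
    show "\<forall>x \<in> ?S. j (i x) = x" "i ` ?S \<subseteq> tableaux (?D f) (replicate_mset a k + M)"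
      using ** by auto
  qed
  then have "card (tableaux (?D f) (replicate_mset a k + M)) = card ?S" by (rule bij_betw_same_card)
  also have "\<dots> = (\<Sum>h \<in> {h \<in> strips a f. h \<le> g}. card (tableaux (?D h) M))"
    by (rule card_SigmaI) (auto simp: finite_strips f finite_tableaux fin)
  also have "\<dots> = (\<Sum>h \<in> strips a f. if h \<le> g then card (tableaux (?D h) M) else 0)"
    by (rule sum.inter_filter) (simp add: finite_strips f)
  finally show ?thesis .
qed

lemma card_tableaux_eq_chains:
  assumes "shape f" "shape g" "f \<le> g" "set_mset M \<subseteq> {k..<k + n}"
  shows "card (tableaux (boxes g - boxes f) M) = chains (map (count M) [k..<k + n]) f g"
  using assms(1,3,4)
proof (induction n arbitrary: k f M)
  case 0
  then have M: "M = {#}" by simp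
  show ?case
  proof (cases "f = g")
    case True
    have "tableaux {} {#} = {\<lambda>_. undefined}" by (auto simp: tableaux_def ssyt_def)
    then show ?thesis using True M by simp
  next
    case False
    then have "boxes g - boxes f \<noteq> {}" using 0 boxes_mono_iff by (metis Diff_eq_empty_iff order_antisym)
    then have "tableaux (boxes g - boxes f) M = {}"
      using M finite_boxes[OF assms(2)] by (auto simp: tableaux_def mset_set_empty_iff)
    then show ?thesis using False by simp
  qed
next
  case (Suc n)
  define M' where "M' = filter_mset (\<lambda>x. x \<noteq> k) M"
  have M: "M = replicate_mset (count M k) k + M'"
    unfolding M'_def by (metis filter_eq_replicate_mset multiset_partition)
  have "card (tableaux (boxes g - boxes f) M)
      = (\<Sum>h \<in> strips (count M k) f. if h \<le> g then card (tableaux (boxes g - boxes h) M') else 0)"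
    by (subst M, rule card_tableaux_peel[OF Suc.prems(1) assms(2) Suc.prems(2)])
      (use Suc.prems(3) in \<open>fastforce simp: M'_def\<close>)
  also have "\<dots> = (\<Sum>h \<in> strips (count M k) f. chains (map (count M) [Suc k..<Suc k + n]) h g)"
  proof (rule sum.cong[OF refl])
    fix h assume h: "h \<in> strips (count M k) f"
    have sh: "shape h" using shape_strips[OF Suc.prems(1) h] .
    have sub: "set_mset M' \<subseteq> {Suc k..<Suc k + n}" using Suc.prems(3) by (force simp: M'_def)
    have "map (count M') [Suc k..<Suc k + n] = map (count M) [Suc k..<Suc k + n]" by (auto simp: M'_def)
    then show "(if h \<le> g then card (tableaux (boxes g - boxes h) M') else 0)
        = chains (map (count M) [Suc k..<Suc k + n]) h g"
      using Suc.IH[OF sh _ sub] chains_nonzero[OF _ sh] by (metis (full_types))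
  qed
  also have "\<dots> = chains (map (count M) [k..<k + Suc n]) f g"
    by (subst (2) upt_conv_Cons) simp_all
  finally show ?case .
qed

section \<open>Power sums and the exponents of a monomial\<close>

lemma series_eqI: "(\<And>M. coefficient f M = coefficient g M) \<Longrightarrow> f = g"
  by (auto simp: coefficient_inject[symmetric])

lemma coefficient_sum: "coefficient (\<Sum>x \<in> A. f x) M = (\<Sum>x \<in> A. coefficient (f x) M)"
  by (induction A rule: infinite_finite_induct) (auto simp: zero_series.rep_eq plus_series.rep_eq)

text \<open>
  A monomial of \<open>psum r\<close> is the \<open>r\<close>-th power of one variable, which has to divide \<open>M\<close>.
\<close>

lemma coefficient_psum_times:
  assumes "r > 0"
  shows "coefficient (psum r * f) M
       = (\<Sum>i | i \<in># M \<and> r \<le> count M i. coefficient f (M - replicate_mset r i))"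
proof -
  let ?S = "{(A, B). A + B = M}" and ?I = "{i. i \<in># M \<and> r \<le> count M i}"
  have "coefficient (psum r * f) M = (\<Sum>(A, B) \<in> ?S. (if \<exists>i. A = replicate_mset r i then 1 else 0) * coefficient f B)"
    by (simp add: times_series.rep_eq psum.rep_eq)
  also have "\<dots> = (\<Sum>(A, B) \<in> {(A, B) \<in> ?S. \<exists>i. A = replicate_mset r i}. coefficient f B)"
    by (rule sum.mono_neutral_cong_right) (auto simp: finite_splittings split: if_splits)
  also have "\<dots> = (\<Sum>i \<in> ?I. coefficient f (M - replicate_mset r i))"
  proof (rule sum.reindex_bij_betw[symmetric, where h = "\<lambda>i. (replicate_mset r i, M - replicate_mset r i)",
        where g = "\<lambda>(A, B). coefficient f B", simplified prod.case])
    show "bij_betw (\<lambda>i. (replicate_mset r i, M - replicate_mset r i)) ?I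
        {(A, B). (A, B) \<in> ?S \<and> (\<exists>i. A = replicate_mset r i)}"
      unfolding bij_betw_def
    proof (intro conjI equalityI subsetI)
      show "inj_on (\<lambda>i. (replicate_mset r i, M - replicate_mset r i)) ?I"
        by (rule inj_onI) (metis Pair_inject assms in_replicate_mset)
    next
      fix x assume "x \<in> (\<lambda>i. (replicate_mset r i, M - replicate_mset r i)) ` ?I"
      then show "x \<in> {(A, B). (A, B) \<in> ?S \<and> (\<exists>i. A = replicate_mset r i)}"
        by (auto simp: count_le_replicate_mset_subset_eq)
    next
      fix x assume "x \<in> {(A, B). (A, B) \<in> ?S \<and> (\<exists>i. A = replicate_mset r i)}"
      then obtain i B where x: "x = (replicate_mset r i, B)" "replicate_mset r i + B = M" by auto
      then have "B = M - replicate_mset r i" "i \<in> ?I" using assms by auto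
      with x show "x \<in> (\<lambda>i. (replicate_mset r i, M - replicate_mset r i)) ` ?I" by auto
    qed
  qed
  finally show ?thesis .
qed

definition exponents :: "nat multiset \<Rightarrow> nat multiset" where
  "exponents M = image_mset (count M) (mset_set (set_mset M))"

lemma size_exponents: "size (exponents M) = card (set_mset M)"
  by (simp add: exponents_def)

lemma sum_exponents: "\<Sum>\<^sub># (exponents M) = size M"
  by (simp add: exponents_def size_multiset_overloaded_eq sum_unfold_sum_mset)

lemma zero_notin_exponents: "0 \<notin># exponents M"
  by (auto simp: exponents_def count_eq_zero_iff)

lemma exponents_empty: "exponents {#} = {#}" by (simp add: exponents_def)

lemma exponents_insert:
  assumes "i \<notin># M" "r > 0"
  shows "exponents (M + replicate_mset r i) = add_mset r (exponents M)"
proof -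
  have "set_mset (M + replicate_mset r i) = insert i (set_mset M)" using assms by auto
  moreover have "image_mset (count (M + replicate_mset r i)) (mset_set (set_mset M)) = image_mset (count M) (mset_set (set_mset M))"
    using assms by (intro image_mset_cong) auto
  moreover have "count M i = 0" using assms by (simp add: count_eq_zero_iff)
  ultimately show ?thesis using assms by (simp add: exponents_def)
qed

lemma exponents_diff:
  assumes "i \<in># M" "r \<le> count M i"
  shows "exponents (M - replicate_mset r i)
       = exponents M - {#count M i#} + (if r = count M i then {#} else {#count M i - r#})"
proof -
  define R where "R = filter_mset (\<lambda>x. x \<noteq> i) M"
  have i: "i \<notin># R" by (simp add: R_def)
  have M: "M = R + replicate_mset (count M i) i"
    unfolding R_def by (metis filter_eq_replicate_mset multiset_partition add.commute)
  have pos: "count M i > 0" using assms by simp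
  have E: "exponents M = add_mset (count M i) (exponents R)"
    using exponents_insert[OF i pos] M by simp
  have "M - replicate_mset r i = R + replicate_mset (count M i - r) i"
    using i assms(2) by (intro multiset_eqI) (auto simp: R_def)
  then show ?thesis using exponents_insert[OF i, of "count M i - r"] assms(2) E by auto
qed

lemma exponents_surj: "0 \<notin># E \<Longrightarrow> \<exists>M. exponents M = E"
proof (induction E)
  case empty
  then show ?case using exponents_empty by blast
next
  case (add r E)
  then obtain M where M: "exponents M = E" by auto
  obtain i where "i \<notin># M" using ex_new_if_finite[OF infinite_UNIV_nat finite_set_mset] by blast
  with exponents_insert[OF this, of r] M add.prems show ?case by auto
qed

text \<open>
  For series in infinitely many variables, invariance under permutations of the variables means that
  a coefficient depends only on the exponents of its monomial.  This form needs no permutations.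
\<close>

definition symmetric :: "series \<Rightarrow> bool" where
  "symmetric f \<longleftrightarrow> (\<forall>M M'. exponents M = exponents M' \<longrightarrow> coefficient f M = coefficient f M')"

definition homogeneous :: "nat \<Rightarrow> series \<Rightarrow> bool" where
  "homogeneous m f \<longleftrightarrow> (\<forall>M. coefficient f M \<noteq> 0 \<longrightarrow> size M = m)"

text \<open>
  Multiplication by \<open>psum r\<close> expressed through exponents alone: an exponent \<open>c\<close> is lowered by \<open>r\<close>, and
  disappears if it becomes zero.
\<close>

lemma psum_times_exponents:
  assumes "symmetric f" "r > 0"
  obtains F where "\<And>M. coefficient f M = F (exponents M)"
    "\<And>M. coefficient (psum r * f) M = (\<Sum>c \<in># exponents M.
       if r \<le> c then F (exponents M - {#c#} + (if r = c then {#} else {#c - r#})) else 0)"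
proof -
  define F where "F E = coefficient f (SOME M. exponents M = E)" for E
  have F: "coefficient f M = F (exponents M)" for M
    using assms(1) someI[of "\<lambda>M'. exponents M' = exponents M" M] unfolding F_def symmetric_def by metis
  have "coefficient (psum r * f) M = (\<Sum>c \<in># exponents M.
       if r \<le> c then F (exponents M - {#c#} + (if r = c then {#} else {#c - r#})) else 0)" for M
  proof -
    have "coefficient (psum r * f) M = (\<Sum>i \<in> {i \<in> set_mset M. r \<le> count M i}.
        F (exponents M - {#count M i#} + (if r = count M i then {#} else {#count M i - r#})))"
      unfolding coefficient_psum_times[OF assms(2)] F
      by (rule sum.cong) (auto simp: exponents_diff)
    also have "\<dots> = (\<Sum>i \<in> set_mset M. if r \<le> count M i then
        F (exponents M - {#count M i#} + (if r = count M i then {#} else {#count M i - r#})) else 0)"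
      by (rule sum.inter_filter) simp
    finally show ?thesis
      by (simp add: exponents_def sum_unfold_sum_mset image_mset.compositionality o_def)
  qed
  with F show thesis by (rule that)
qed

lemma symmetric_psum_times: "symmetric f \<Longrightarrow> r > 0 \<Longrightarrow> symmetric (psum r * f)"
proof -
  assume "symmetric f" "r > 0"
  then obtain F where F: "\<And>M. coefficient (psum r * f) M = (\<Sum>c \<in># exponents M.
       if r \<le> c then F (exponents M - {#c#} + (if r = c then {#} else {#c - r#})) else 0)"
    by (rule psum_times_exponents) blast
  show ?thesis unfolding symmetric_def
  proof (intro allI impI)
    fix M M' assume e: "exponents M = exponents M'"
    show "coefficient (psum r * f) M = coefficient (psum r * f) M'" unfolding F e ..
  qed
qed

lemma psum_part_simps: "psum_part [] = 1" "psum_part (r # \<mu>) = psum r * psum_part \<mu>"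
  by (simp_all add: psum_part_def)

lemma symmetric_psum_part: "0 \<notin> set \<mu> \<Longrightarrow> symmetric (psum_part \<mu>)"
proof (induction \<mu>)
  case Nil
  have "M = {#} \<longleftrightarrow> exponents M = {#}" for M
    by (metis exponents_empty size_exponents card_0_eq finite_set_mset set_mset_eq_empty_iff size_empty)
  then have "(M = {#}) = (M' = {#})" if "exponents M = exponents M'" for M M' using that by metis
  then show ?case unfolding symmetric_def psum_part_simps one_series.rep_eq by (metis (full_types))
qed (simp add: psum_part_simps symmetric_psum_times)

lemma psum_part_nonneg: "0 \<notin> set \<mu> \<Longrightarrow> coefficient (psum_part \<mu>) M \<ge> 0"
  by (induction \<mu> arbitrary: M)
    (auto simp: psum_part_simps one_series.rep_eq coefficient_psum_times intro!: sum_nonneg)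

text \<open>
  Triangularity.  Each factor \<open>psum r\<close> adds \<open>r\<close> to one exponent, so it introduces at most one new
  variable, and if it always does then the exponents are the parts of \<open>\<mu>\<close>.
\<close>

lemma psum_part_nonzero:
  assumes "coefficient (psum_part \<mu>) M \<noteq> 0" "0 \<notin> set \<mu>"
  shows "size M = sum_list \<mu> \<and> size (exponents M) \<le> length \<mu> \<and>
    (size (exponents M) = length \<mu> \<longrightarrow> exponents M = mset \<mu>)"
  using assms
proof (induction \<mu> arbitrary: M)
  case Nil
  then show ?case by (auto simp: psum_part_simps one_series.rep_eq exponents_empty split: if_splits)
next
  case (Cons r \<mu>)
  have r: "r > 0" and \<mu>: "0 \<notin> set \<mu>" using Cons.prems by auto
  from Cons.prems(1) have "(\<Sum>i | i \<in># M \<and> r \<le> count M i. coefficient (psum_part \<mu>) (M - replicate_mset r i)) \<noteq> 0"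
    by (simp only: psum_part_simps coefficient_psum_times[OF r]) simp
  then obtain i where i: "i \<in># M" "r \<le> count M i" "coefficient (psum_part \<mu>) (M - replicate_mset r i) \<noteq> 0"
    by (rule sum.not_neutral_contains_not_neutral) blast
  note IH = Cons.IH[OF i(3) \<mu>]
  have sub: "replicate_mset r i \<subseteq># M" using i(2) by (simp add: count_le_replicate_mset_subset_eq)
  have c: "count M i \<in># exponents M" using i(1) by (auto simp: exponents_def)
  have sz: "size M = sum_list (r # \<mu>)" 
  proof -
    have "size M = size (M - replicate_mset r i) + size (replicate_mset r i)"
      by (metis size_union subset_mset.diff_add sub)
    then show ?thesis using IH by simp
  qed
  note d = exponents_diff[OF i(1,2)]
  from c obtain X where X: "exponents M = add_mset (count M i) X" by (meson multi_member_split)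
  show ?case
  proof (cases "r = count M i")
    case True
    then have "exponents (M - replicate_mset r i) = X" using d X by simp
    with IH sz X True show ?thesis by simp
  next
    case False
    then have "size (exponents (M - replicate_mset r i)) = size (exponents M)" using d X by simp
    with IH sz show ?thesis by simp
  qed
qed

lemma psum_part_pos:
  "exponents M = mset \<mu> \<Longrightarrow> 0 \<notin> set \<mu> \<Longrightarrow> coefficient (psum_part \<mu>) M > 0"
proof (induction \<mu> arbitrary: M)
  case Nil
  then have "M = {#}" by (metis mset.simps(1) size_empty size_exponents card_0_eq finite_set_mset set_mset_eq_empty_iff)
  then show ?case by (simp add: psum_part_simps one_series.rep_eq)
next
  case (Cons r \<mu>)
  then have r: "r > 0" "0 \<notin> set \<mu>" by auto
  from Cons.prems(1) have "r \<in># exponents M" by simp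
  then obtain i where i: "i \<in># M" "count M i = r" by (auto simp: exponents_def)
  have "exponents (M - replicate_mset r i) = mset \<mu>"
    using exponents_diff[of i M r] i Cons.prems(1) by simp
  from Cons.IH[OF this r(2)] i show ?case
    unfolding psum_part_simps coefficient_psum_times[OF r(1)]
    by (intro sum_pos2[of _ i]) (auto simp: psum_part_nonneg r)
qed

lemma partition_unique: "is_partition \<kappa> \<Longrightarrow> is_partition \<mu> \<Longrightarrow> mset \<kappa> = mset \<mu> \<Longrightarrow> \<kappa> = \<mu>"
proof -
  assume p: "is_partition \<kappa>" "is_partition \<mu>" "mset \<kappa> = mset \<mu>"
  have "sort \<mu> = rev \<kappa>" "sort \<mu> = rev \<mu>"
    by (rule properties_for_sort; use p in \<open>simp add: is_partition_def sorted_wrt_rev\<close>)+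
  then show "\<kappa> = \<mu>" by simp
qed

definition partition_of_mset :: "nat multiset \<Rightarrow> nat list" where
  "partition_of_mset E = rev (sorted_list_of_multiset E)"

lemma mset_partition_of_mset: "mset (partition_of_mset E) = E" by (simp add: partition_of_mset_def)

lemma is_partition_partition_of_mset: "0 \<notin># E \<Longrightarrow> is_partition (partition_of_mset E)"
  by (auto simp: is_partition_def partition_of_mset_def sorted_wrt_rev)

lemma partition_of_mset_mset: "is_partition \<kappa> \<Longrightarrow> partition_of_mset (mset \<kappa>) = \<kappa>"
  by (rule partition_unique[OF is_partition_partition_of_mset _ mset_partition_of_mset]) (simp_all add: is_partition_def)

definition partitions :: "nat \<Rightarrow> nat list set" where
  "partitions m = {\<kappa>. partition_of m \<kappa>}"

lemma partitions_iff: "\<kappa> \<in> partitions m \<longleftrightarrow> is_partition \<kappa> \<and> sum_list \<kappa> = m"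
  by (simp add: partitions_def partition_of_def)

lemma length_le_sum_list: "0 \<notin> set xs \<Longrightarrow> length xs \<le> sum_list (xs :: nat list)"
  by (induction xs) auto

lemma finite_partitions: "finite (partitions m)"
proof (rule finite_subset)
  show "partitions m \<subseteq> {xs. set xs \<subseteq> {..m} \<and> length xs \<le> m}"
    using length_le_sum_list by (auto simp: partitions_iff is_partition_def member_le_sum_list)
qed (rule finite_lists_length_le, simp)

definition psum_combination :: "nat \<Rightarrow> (nat list \<Rightarrow> rat) \<Rightarrow> series" where
  "psum_combination m c = (\<Sum>\<kappa> \<in> partitions m. qscale (c \<kappa>) (psum_part \<kappa>))"

lemma coefficient_psum_combination:
  "coefficient (psum_combination m c) M = (\<Sum>\<kappa> \<in> partitions m. c \<kappa> * coefficient (psum_part \<kappa>) M)"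
  by (simp add: psum_combination_def coefficient_sum qscale.rep_eq)

text \<open>
  Among the partitions with nonzero coefficient take a longest one, \<open>\<nu>\<close>.  By triangularity no
  other of them contributes to a monomial whose exponents are the parts of \<open>\<nu>\<close>.
\<close>

lemma psum_independent:
  assumes "finite P" "\<And>\<kappa>. \<kappa> \<in> P \<Longrightarrow> is_partition \<kappa>"
    and "(\<Sum>\<kappa> \<in> P. qscale (c \<kappa>) (psum_part \<kappa>)) = 0" and "\<kappa> \<in> P"
  shows "c \<kappa> = 0"
proof (rule ccontr)
  assume "c \<kappa> \<noteq> 0"
  let ?B = "{\<mu> \<in> P. c \<mu> \<noteq> 0}"
  have B: "finite ?B" "?B \<noteq> {}" using assms \<open>c \<kappa> \<noteq> 0\<close> by auto
  then have "Max (length ` ?B) \<in> length ` ?B" by (intro Max_in) (simp_all only: finite_imageI image_is_empty not_False_eq_True)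
  then obtain \<nu> where "\<nu> \<in> ?B" and max: "length \<nu> = Max (length ` ?B)" by (metis (lifting) imageE)
  moreover have "length \<mu> \<le> length \<nu>" if "\<mu> \<in> ?B" for \<mu>
    unfolding max using B(1) that by (intro Max_ge imageI finite_imageI)
  ultimately have \<nu>: "\<nu> \<in> ?B" "\<And>\<mu>. \<mu> \<in> ?B \<Longrightarrow> length \<mu> \<le> length \<nu>" by blast+
  have p: "is_partition \<nu>" "0 \<notin> set \<nu>" using \<nu> assms(2) by (auto simp: is_partition_def)
  then obtain M where M: "exponents M = mset \<nu>" using exponents_surj[of "mset \<nu>"] by auto
  have "0 = coefficient (\<Sum>\<kappa> \<in> P. qscale (c \<kappa>) (psum_part \<kappa>)) M"
    unfolding assms(3) by (simp add: zero_series.rep_eq)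
  also have "\<dots> = (\<Sum>\<mu> \<in> P. c \<mu> * coefficient (psum_part \<mu>) M)"
    by (simp add: coefficient_sum qscale.rep_eq)
  also have "\<dots> = (\<Sum>\<mu> \<in> {\<nu>}. c \<mu> * coefficient (psum_part \<mu>) M)"
  proof (rule sum.mono_neutral_right)
    show "\<forall>\<mu> \<in> P - {\<nu>}. c \<mu> * coefficient (psum_part \<mu>) M = 0"
    proof (rule ballI, rule ccontr)
      fix \<mu> assume \<mu>: "\<mu> \<in> P - {\<nu>}" and nz: "c \<mu> * coefficient (psum_part \<mu>) M \<noteq> 0"
      then have "length \<mu> \<le> length \<nu>" "is_partition \<mu>" using \<nu>(2)[of \<mu>] assms(2) by auto
      moreover from this have "0 \<notin> set \<mu>" by (simp add: is_partition_def)
      ultimately have "mset \<nu> = mset \<mu>" using psum_part_nonzero[of \<mu> M] nz M by auto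
      then show False using partition_unique[OF p(1) \<open>is_partition \<mu>\<close>] \<mu> by auto
    qed
  qed (use assms \<nu> in auto)
  finally show False using psum_part_pos[OF M p(2)] \<nu>(1) by auto
qed

lemma psum_coeffs_combination:
  "psum_coeffs (psum_combination m c) = (\<lambda>\<kappa>. if \<kappa> \<in> partitions m then c \<kappa> else 0)" (is "_ = ?d")
  unfolding psum_coeffs_def
proof (rule the_equality)
  have "finite {\<mu>. ?d \<mu> \<noteq> 0}" by (rule finite_subset[OF _ finite_partitions[of m]]) auto
  moreover have "psum_combination m c = (\<Sum>\<mu> | ?d \<mu> \<noteq> 0. qscale (?d \<mu>) (psum_part \<mu>))"
    unfolding psum_combination_def
    by (rule sum.mono_neutral_cong_right)
      (auto simp: finite_partitions partitions_iff qscale.rep_eq zero_series.rep_eq intro!: series_eqI)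
  ultimately show "finite {\<mu>. ?d \<mu> \<noteq> 0} \<and> (\<forall>\<mu>. ?d \<mu> \<noteq> 0 \<longrightarrow> is_partition \<mu>) \<and>
      psum_combination m c = (\<Sum>\<mu> | ?d \<mu> \<noteq> 0. qscale (?d \<mu>) (psum_part \<mu>))"
    by (auto simp: partitions_iff)
next
  fix e assume e: "finite {\<mu>. e \<mu> \<noteq> 0} \<and> (\<forall>\<mu>. e \<mu> \<noteq> 0 \<longrightarrow> is_partition \<mu>) \<and>
      psum_combination m c = (\<Sum>\<mu> | e \<mu> \<noteq> 0. qscale (e \<mu>) (psum_part \<mu>))"
  let ?P = "{\<mu>. e \<mu> \<noteq> 0} \<union> partitions m"
  have 1: "psum_combination m c = (\<Sum>\<mu> \<in> ?P. qscale (?d \<mu>) (psum_part \<mu>))"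
    unfolding psum_combination_def
    by (rule sum.mono_neutral_cong_left)
      (use e in \<open>auto simp: finite_partitions qscale.rep_eq zero_series.rep_eq intro!: series_eqI\<close>)
  have 2: "psum_combination m c = (\<Sum>\<mu> \<in> ?P. qscale (e \<mu>) (psum_part \<mu>))"
    unfolding e[THEN conjunct2, THEN conjunct2]
    by (rule sum.mono_neutral_left)
      (use e in \<open>auto simp: finite_partitions qscale.rep_eq zero_series.rep_eq intro!: series_eqI\<close>)
  have "(\<Sum>\<mu> \<in> ?P. qscale (e \<mu> - ?d \<mu>) (psum_part \<mu>))
      = (\<Sum>\<mu> \<in> ?P. qscale (e \<mu>) (psum_part \<mu>)) - (\<Sum>\<mu> \<in> ?P. qscale (?d \<mu>) (psum_part \<mu>))"
    by (rule series_eqI) (simp add: coefficient_sum minus_series.rep_eq qscale.rep_eq left_diff_distrib sum_subtractf)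
  then have 3: "(\<Sum>\<mu> \<in> ?P. qscale (e \<mu> - ?d \<mu>) (psum_part \<mu>)) = 0" using 1 2 by simp
  show "e = ?d"
  proof
    fix \<mu> show "e \<mu> = ?d \<mu>"
    proof (cases "\<mu> \<in> ?P")
      case True
      have "e \<mu> - ?d \<mu> = 0"
        by (rule psum_independent[OF _ _ 3 True]) (use e finite_partitions in \<open>auto simp: partitions_iff\<close>)
      then show ?thesis by simp
    qed auto
  qed
qed

lemma kronecker_combination:
  "kronecker (psum_combination m c) (psum_combination m d) = psum_combination m (\<lambda>\<kappa>. c \<kappa> * d \<kappa> * zee \<kappa>)"
proof -
  let ?P = "partitions m"
  have sup: "{\<mu>. (if \<mu> \<in> ?P then c \<mu> else 0) \<noteq> 0} \<subseteq> ?P" for c :: "nat list \<Rightarrow> rat" by auto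
  have q0: "qscale 0 f = 0" for f by (rule series_eqI) (simp add: qscale.rep_eq zero_series.rep_eq)
  have q1: "qscale x 0 = 0" for x by (rule series_eqI) (simp add: qscale.rep_eq zero_series.rep_eq)
  have q2: "qscale x (qscale y f) = qscale (x * y) f" for x y f by (rule series_eqI) (simp add: qscale.rep_eq)
  have "kronecker (psum_combination m c) (psum_combination m d)
      = (\<Sum>\<mu> \<in> ?P. \<Sum>\<nu> | (if \<nu> \<in> ?P then d \<nu> else 0) \<noteq> 0.
     qscale ((if \<mu> \<in> ?P then c \<mu> else 0) * (if \<nu> \<in> ?P then d \<nu> else 0))
       (if \<mu> = \<nu> then qscale (zee \<mu>) (psum_part \<mu>) else 0))"
    unfolding kronecker_def psum_coeffs_combination
    by (rule sum.mono_neutral_left[OF finite_partitions sup]) (auto simp: q0)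
  also have "\<dots> = (\<Sum>\<mu> \<in> ?P. \<Sum>\<nu> \<in> ?P.
     qscale ((if \<mu> \<in> ?P then c \<mu> else 0) * (if \<nu> \<in> ?P then d \<nu> else 0))
       (if \<mu> = \<nu> then qscale (zee \<mu>) (psum_part \<mu>) else 0))"
    by (intro sum.cong refl sum.mono_neutral_left[OF finite_partitions sup]) (auto simp: q0)
  also have "\<dots> = (\<Sum>\<mu> \<in> ?P. \<Sum>\<nu> \<in> ?P. if \<mu> = \<nu> then qscale (c \<mu> * d \<mu> * zee \<mu>) (psum_part \<mu>) else 0)"
    by (intro sum.cong refl) (auto simp: q1 q2)
  also have "\<dots> = psum_combination m (\<lambda>\<kappa>. c \<kappa> * d \<kappa> * zee \<kappa>)"
    unfolding psum_combination_def by (intro sum.cong refl) (simp add: finite_partitions)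
  finally show ?thesis .
qed

text \<open>
  The monomials with the most variables can be cancelled by subtracting power sum products, by
  triangularity.  This lowers the number of variables per monomial, until nothing remains.
\<close>

lemma symmetric_eq_combination:
  assumes "symmetric f" "homogeneous m f"
  obtains c where "f = psum_combination m c"
proof -
  have *: "\<exists>c. f = psum_combination m c"
    if "symmetric f" "homogeneous m f" "\<And>M. l \<le> size (exponents M) \<Longrightarrow> coefficient f M = 0" for l f
    using that
  proof (induction l arbitrary: f)
    case 0
    then have "f = psum_combination m (\<lambda>_. 0)"
      by (intro series_eqI) (simp add: coefficient_psum_combination)
    then show ?case by blast
  next
    case (Suc l)
    define rep where "rep \<kappa> = (SOME M. exponents M = mset \<kappa>)" for \<kappa>
    have rep: "exponents (rep \<kappa>) = mset \<kappa>" if "0 \<notin> set \<kappa>" for \<kappa>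
      unfolding rep_def using exponents_surj[of "mset \<kappa>"] that by (auto intro: someI_ex)
    \<comment> \<open>By triangularity this choice matches \<open>f\<close> on all monomials in exactly \<open>l\<close> variables, and adds
      nothing on monomials in more variables.\<close>
    define c where "c \<kappa> = (if length \<kappa> = l then coefficient f (rep \<kappa>) / coefficient (psum_part \<kappa>) (rep \<kappa>) else 0)" for \<kappa>
    let ?f = "f - psum_combination m c"
    have p0: "0 \<notin> set \<kappa>" if "\<kappa> \<in> partitions m" for \<kappa> using that by (simp add: partitions_iff is_partition_def)
    have 1: "symmetric ?f"
      unfolding symmetric_def
    proof (intro allI impI)
      fix M M' :: "nat multiset" assume e: "exponents M = exponents M'"
      have "coefficient (psum_part \<kappa>) M = coefficient (psum_part \<kappa>) M'" if "\<kappa> \<in> partitions m" for \<kappa>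
        using symmetric_psum_part[OF p0[OF that]] e unfolding symmetric_def by blast
      moreover have "coefficient f M = coefficient f M'" using Suc.prems(1) e unfolding symmetric_def by blast
      ultimately show "coefficient ?f M = coefficient ?f M'"
        by (simp add: minus_series.rep_eq coefficient_psum_combination)
    qed
    have 2: "homogeneous m ?f"
      unfolding homogeneous_def
    proof (intro allI impI, rule ccontr)
      fix M assume nz: "coefficient ?f M \<noteq> 0" and "size M \<noteq> m"
      then have "coefficient f M = 0" using Suc.prems(2) by (auto simp: homogeneous_def)
      moreover have "coefficient (psum_part \<kappa>) M = 0" if "\<kappa> \<in> partitions m" for \<kappa>
        using psum_part_nonzero[of \<kappa> M] p0[OF that] that \<open>size M \<noteq> m\<close> by (auto simp: partitions_iff)
      ultimately show False using nz by (simp add: minus_series.rep_eq coefficient_psum_combination)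
    qed
    have 3: "coefficient ?f M = 0" if "l \<le> size (exponents M)" for M
    proof -
      define \<kappa> where "\<kappa> = partition_of_mset (exponents M)"
      have l: "is_partition \<kappa>" "mset \<kappa> = exponents M" "sum_list \<kappa> = size M" "0 \<notin> set \<kappa>"
        unfolding \<kappa>_def set_mset_mset[symmetric] sum_mset_sum_list[symmetric] mset_partition_of_mset sum_exponents
        using is_partition_partition_of_mset[OF zero_notin_exponents] zero_notin_exponents by auto
      have z: "c \<mu> * coefficient (psum_part \<mu>) M = 0" if "\<mu> \<in> partitions m" "\<mu> \<noteq> \<kappa>" for \<mu>
      proof (rule ccontr)
        assume nz: "c \<mu> * coefficient (psum_part \<mu>) M \<noteq> 0"
        then have "length \<mu> = l" by (auto simp: c_def split: if_splits)
        with nz psum_part_nonzero[OF _ p0[OF that(1)], of M] \<open>l \<le> size (exponents M)\<close>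
        have "mset \<mu> = mset \<kappa>" using l by auto
        with partition_unique[OF _ l(1)] that show False by (auto simp: partitions_iff)
      qed
      have "coefficient f M = coefficient (psum_combination m c) M"
      proof (cases "\<kappa> \<in> partitions m")
        case False
        then have "size M \<noteq> m" using l by (auto simp: partitions_iff)
        then have "coefficient f M = 0" using Suc.prems(2) by (auto simp: homogeneous_def)
        moreover have "coefficient (psum_combination m c) M = 0"
          unfolding coefficient_psum_combination using z False by (intro sum.neutral) metis
        ultimately show ?thesis by simp
      next
        case True
        have "coefficient (psum_combination m c) M = (\<Sum>\<mu> \<in> {\<kappa>}. c \<mu> * coefficient (psum_part \<mu>) M)"
          unfolding coefficient_psum_combination
          by (rule sum.mono_neutral_right) (use True z finite_partitions in auto)
        then have eq: "coefficient (psum_combination m c) M = c \<kappa> * coefficient (psum_part \<kappa>) M" by simp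
        have e: "exponents (rep \<kappa>) = exponents M" using rep l by metis
        show ?thesis
        proof (cases "length \<kappa> = l")
          case len: True
          have "coefficient (psum_part \<kappa>) (rep \<kappa>) = coefficient (psum_part \<kappa>) M"
            "coefficient f (rep \<kappa>) = coefficient f M"
            using e symmetric_psum_part[OF l(4)] Suc.prems(1) unfolding symmetric_def by blast+
          moreover have "coefficient (psum_part \<kappa>) M > 0" using psum_part_pos l by metis
          ultimately show ?thesis unfolding eq c_def using len by simp
        next
          case False
          then have "Suc l \<le> size (exponents M)" using that l(2) by (metis le_antisym not_less_eq_eq size_mset)
          then show ?thesis unfolding eq c_def using False Suc.prems(3) by simp
        qed
      qed
      then show ?thesis by (simp add: minus_series.rep_eq)
    qed
    from Suc.IH[OF 1 2 3] obtain d where "?f = psum_combination m d" by blast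
    then have "f = psum_combination m c + psum_combination m d" by (simp add: algebra_simps)
    also have "\<dots> = psum_combination m (\<lambda>\<kappa>. c \<kappa> + d \<kappa>)"
      by (rule series_eqI) (simp add: plus_series.rep_eq coefficient_psum_combination distrib_right sum.distrib)
    finally show ?case by blast
  qed
  have "\<exists>c. f = psum_combination m c"
  proof (rule *[OF assms, of "Suc m"])
    fix M assume *: "Suc m \<le> size (exponents M)"
    have "size (exponents M) \<le> sum_mset (exponents M)"
      using length_le_sum_list[of "partition_of_mset (exponents M)"] zero_notin_exponents[of M]
      unfolding size_mset[symmetric] sum_mset_sum_list[symmetric] set_mset_mset[symmetric] mset_partition_of_mset .
    then show "coefficient f M = 0" using assms(2) * by (auto simp: homogeneous_def sum_exponents)
  qed
  with that show thesis by blast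
qed

section \<open>The derivative by the first power sum\<close>

lemma psum_part_cong: "mset \<mu> = mset \<nu> \<Longrightarrow> psum_part \<mu> = psum_part \<nu>"
  unfolding psum_part_def by (metis mset_map prod_mset_prod_list)

lemma psum_part_remove: "r \<in> set \<mu> \<Longrightarrow> psum r * psum_part (remove1 r \<mu>) = psum_part \<mu>"
  unfolding psum_part_simps(2)[symmetric] by (rule psum_part_cong) simp

lemma times_qscale: "f * qscale c g = qscale c (f * g)"
  by (rule series_eqI) (auto simp: times_series.rep_eq qscale.rep_eq sum_distrib_left intro!: sum.cong)

lemma coefficient_of_nat_times: "coefficient (of_nat n * f) M = of_nat n * coefficient f M"
  by (induction n) (simp_all add: distrib_right plus_series.rep_eq zero_series.rep_eq)

text \<open>
  The variable \<open>N\<close> occurs to the first power in the monomial, so it must come from a factor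
  \<open>psum 1\<close>.  Choosing this factor is differentiation by \<open>psum 1\<close>.
\<close>

lemma coefficient_psum_part_fresh:
  assumes "N \<notin># M" "0 \<notin> set \<mu>"
  shows "coefficient (psum_part \<mu>) (add_mset N M)
       = of_nat (count_list \<mu> 1) * coefficient (psum_part (remove1 1 \<mu>)) M"
  using assms
proof (induction \<mu> arbitrary: M)
  case Nil
  then show ?case by (simp add: psum_part_simps one_series.rep_eq)
next
  case (Cons r \<mu>)
  have r: "r > 0" and \<mu>: "0 \<notin> set \<mu>" using Cons.prems by auto
  let ?I = "{i. i \<in># M \<and> r \<le> count M i}"
  have N0: "count M N = 0" using Cons.prems(1) by (simp add: count_eq_zero_iff)
  have I: "{i. i \<in># add_mset N M \<and> r \<le> count (add_mset N M) i} = (if r = 1 then insert N ?I else ?I)"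
    using r N0 Cons.prems(1) by (auto split: if_splits)
  have fin: "finite ?I" by (rule finite_subset[of _ "set_mset M"]) auto
  have rest: "(\<Sum>i \<in> ?I. coefficient (psum_part \<mu>) (add_mset N M - replicate_mset r i))
      = of_nat (count_list \<mu> 1) * coefficient (psum r * psum_part (remove1 1 \<mu>)) M"
    unfolding coefficient_psum_times[OF r] sum_distrib_left
  proof (rule sum.cong[OF refl])
    fix i assume i: "i \<in> ?I"
    then have "replicate_mset r i \<subseteq># M" by (simp add: count_le_replicate_mset_subset_eq)
    then have "add_mset N M - replicate_mset r i = add_mset N (M - replicate_mset r i)"
      by (metis add_mset_add_single multiset_diff_union_assoc union_commute add_mset_diff_bothsides subset_mset.diff_add_assoc2)
    moreover have "N \<notin># M - replicate_mset r i" using Cons.prems(1) by (meson in_diffD)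
    ultimately show "coefficient (psum_part \<mu>) (add_mset N M - replicate_mset r i)
        = of_nat (count_list \<mu> 1) * coefficient (psum_part (remove1 1 \<mu>)) (M - replicate_mset r i)"
      using Cons.IH \<mu> by simp
  qed
  have lhs: "coefficient (psum_part (r # \<mu>)) (add_mset N M)
      = (\<Sum>i \<in> (if r = 1 then insert N ?I else ?I). coefficient (psum_part \<mu>) (add_mset N M - replicate_mset r i))"
    unfolding psum_part_simps coefficient_psum_times[OF r] I ..
  show ?case
  proof (cases "r = 1")
    case True
    have "coefficient (psum_part (r # \<mu>)) (add_mset N M) = coefficient (psum_part \<mu>) M
        + of_nat (count_list \<mu> 1) * coefficient (psum r * psum_part (remove1 1 \<mu>)) M"
      unfolding lhs rest[symmetric] using True fin Cons.prems(1) by simp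
    also have "of_nat (count_list \<mu> 1) * coefficient (psum r * psum_part (remove1 1 \<mu>)) M
        = of_nat (count_list \<mu> 1) * coefficient (psum_part \<mu>) M"
      using True psum_part_remove[of 1 \<mu>] by (cases "1 \<in> set \<mu>") (simp_all add: count_list_0_iff)
    finally show ?thesis using True by (simp add: algebra_simps)
  next
    case False
    then show ?thesis unfolding lhs using rest by (simp add: psum_part_simps)
  qed
qed

text \<open>
  The series \<open>g\<close> is the derivative by \<open>psum 1\<close>, and multiplying it by \<open>psum 1\<close> restores the degree;
  on each product of power sums the result is multiplication by the number of parts equal to one.
\<close>

lemma psum_one_times_fresh:
  assumes "\<And>M. \<exists>N. N \<notin># M \<and> coefficient (psum_combination m c) (add_mset N M) = coefficient g M"
  shows "psum 1 * g = psum_combination m (\<lambda>\<kappa>. of_nat (count_list \<kappa> 1) * c \<kappa>)"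
proof -
  have "g = (\<Sum>\<kappa> \<in> partitions m. qscale (of_nat (count_list \<kappa> 1) * c \<kappa>) (psum_part (remove1 1 \<kappa>)))"
  proof (rule series_eqI)
    fix M
    obtain N where N: "N \<notin># M" "coefficient (psum_combination m c) (add_mset N M) = coefficient g M"
      using assms by blast
    have "coefficient (psum_part \<kappa>) (add_mset N M)
        = of_nat (count_list \<kappa> 1) * coefficient (psum_part (remove1 1 \<kappa>)) M" if "\<kappa> \<in> partitions m" for \<kappa>
      by (rule coefficient_psum_part_fresh[OF N(1)]) (use that in \<open>simp add: partitions_iff is_partition_def\<close>)
    then show "coefficient g M = coefficient (\<Sum>\<kappa> \<in> partitions m. qscale (of_nat (count_list \<kappa> 1) * c \<kappa>) (psum_part (remove1 1 \<kappa>))) M"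
      unfolding N(2)[symmetric] coefficient_psum_combination coefficient_sum qscale.rep_eq
      by (auto intro!: sum.cong)
  qed
  then have "psum 1 * g = (\<Sum>\<kappa> \<in> partitions m. qscale (of_nat (count_list \<kappa> 1) * c \<kappa>) (psum 1 * psum_part (remove1 1 \<kappa>)))"
    by (simp add: sum_distrib_left times_qscale)
  also have "\<dots> = psum_combination m (\<lambda>\<kappa>. of_nat (count_list \<kappa> 1) * c \<kappa>)"
    unfolding psum_combination_def
  proof (rule sum.cong[OF refl])
    fix \<kappa>
    show "qscale (of_nat (count_list \<kappa> 1) * c \<kappa>) (psum 1 * psum_part (remove1 1 \<kappa>))
        = qscale (of_nat (count_list \<kappa> 1) * c \<kappa>) (psum_part \<kappa>)"
    proof (cases "1 \<in> set \<kappa>")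
      case True
      show ?thesis unfolding psum_part_remove[OF True] ..
    next
      case False
      then show ?thesis by (intro series_eqI) (simp add: qscale.rep_eq count_list_0_iff)
    qed
  qed
  finally show ?thesis .
qed

section \<open>The Kronecker product with a hook\<close>

lemma zee_superset:
  assumes "finite S" "set \<mu> \<subseteq> S"
  shows "zee \<mu> = (\<Prod>i \<in> S. of_nat (i ^ count_list \<mu> i * fact (count_list \<mu> i)))"
  unfolding zee_def by (rule prod.mono_neutral_left) (use assms in \<open>auto simp: count_notin\<close>)

lemma zee_add_part:
  assumes "mset \<kappa> = add_mset r (mset \<mu>)"
  shows "zee \<kappa> = of_nat (r * count_list \<kappa> r) * zee \<mu>"
proof -
  have cl: "count_list \<kappa> i = (if i = r then Suc (count_list \<mu> i) else count_list \<mu> i)" for i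
    using arg_cong[OF assms, of "\<lambda>X. count X i"] by (simp add: count_mset)
  have s: "set \<kappa> = insert r (set \<mu>)" using arg_cong[OF assms, of set_mset] by simp
  let ?w = "\<lambda>\<mu> i. of_nat (i ^ count_list \<mu> i * fact (count_list \<mu> i)) :: rat"
  have "zee \<kappa> = ?w \<kappa> r * (\<Prod>i \<in> set \<kappa> - {r}. ?w \<kappa> i)"
    unfolding zee_def by (rule prod.remove) (simp_all add: s)
  also have "(\<Prod>i \<in> set \<kappa> - {r}. ?w \<kappa> i) = (\<Prod>i \<in> set \<kappa> - {r}. ?w \<mu> i)"
    by (rule prod.cong) (auto simp: cl)
  also have "?w \<kappa> r = of_nat (r * count_list \<kappa> r) * ?w \<mu> r"
    by (simp add: cl algebra_simps)
  also have "of_nat (r * count_list \<kappa> r) * ?w \<mu> r * (\<Prod>i \<in> set \<kappa> - {r}. ?w \<mu> i)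
      = of_nat (r * count_list \<kappa> r) * (\<Prod>i \<in> set \<kappa>. ?w \<mu> i)"
    by (subst (2) prod.remove[of _ r]) (simp_all add: s mult.assoc)
  also have "(\<Prod>i \<in> set \<kappa>. ?w \<mu> i) = zee \<mu>" by (rule zee_superset[symmetric]) (auto simp: s)
  finally show ?thesis .
qed

lemma zee_nonzero: "0 \<notin> set \<mu> \<Longrightarrow> zee \<mu> \<noteq> 0"
  unfolding zee_def by (auto simp: prod_zero_iff) 

lemma is_partition_remove1: "is_partition \<kappa> \<Longrightarrow> is_partition (remove1 r \<kappa>)"
  unfolding is_partition_def by (induction \<kappa>) (auto dest: subsetD[OF set_remove1_subset])

text \<open>
  Inserting a part \<open>r\<close> multiplies \<open>zee\<close> by \<open>r\<close> times the new multiplicity of \<open>r\<close>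
  (\<open>zee_add_part\<close>).  The case \<open>r = 1\<close> gives the expansion of $h_{m-1} h_1$; the sum over all \<open>r\<close>
  is Newton's recursion for $\sum_\lambda z_\lambda^{-1} p_\lambda$.
\<close>

lemma psum_times_inverse_zee:
  assumes "0 < r" "r \<le> m"
  shows "psum r * psum_combination (m - r) (\<lambda>\<kappa>. 1 / zee \<kappa>)
       = psum_combination m (\<lambda>\<kappa>. of_nat (r * count_list \<kappa> r) / zee \<kappa>)"
proof -
  have p0: "0 \<notin> set \<kappa>" if "\<kappa> \<in> partitions m" for \<kappa> m
    using that by (simp add: partitions_iff is_partition_def)
  let ?S = "{\<kappa> \<in> partitions m. r \<in> set \<kappa>}"
  have "psum r * psum_combination (m - r) (\<lambda>\<kappa>. 1 / zee \<kappa>)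
      = (\<Sum>\<mu> \<in> partitions (m - r). qscale (1 / zee \<mu>) (psum_part (r # \<mu>)))"
    by (simp add: psum_combination_def sum_distrib_left times_qscale psum_part_simps)
  also have "\<dots> = (\<Sum>\<kappa> \<in> ?S. qscale (of_nat (r * count_list \<kappa> r) / zee \<kappa>) (psum_part \<kappa>))"
  proof (rule sum.reindex_bij_witness[where i = "remove1 r" and j = "\<lambda>\<mu>. partition_of_mset (mset (r # \<mu>))"])
    fix \<kappa> assume \<kappa>: "\<kappa> \<in> ?S"
    then have p: "is_partition \<kappa>" "sum_list \<kappa> = m" "mset (r # remove1 r \<kappa>) = mset \<kappa>" by (auto simp: partitions_iff)
    show "partition_of_mset (mset (r # remove1 r \<kappa>)) = \<kappa>" unfolding p(3) by (rule partition_of_mset_mset[OF p(1)])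
    have "sum_list \<kappa> = r + sum_list (remove1 r \<kappa>)"
      using arg_cong[OF p(3), of sum_mset] unfolding sum_mset_sum_list by simp
    then show "remove1 r \<kappa> \<in> partitions (m - r)"
      using p(2) is_partition_remove1[OF p(1)] by (simp add: partitions_iff)
  next
    fix \<mu> assume \<mu>: "\<mu> \<in> partitions (m - r)"
    let ?\<kappa> = "partition_of_mset (mset (r # \<mu>))"
    have k: "mset ?\<kappa> = add_mset r (mset \<mu>)" by (simp add: mset_partition_of_mset)
    have sk: "set ?\<kappa> = insert r (set \<mu>)" using arg_cong[OF k, of set_mset] by simp
    have pk: "is_partition ?\<kappa>" by (rule is_partition_partition_of_mset) (use \<mu> p0 assms in auto)
    have "sum_list ?\<kappa> = m"
      using arg_cong[OF k, of sum_mset] \<mu> assms unfolding sum_mset_sum_list by (simp add: partitions_iff sum_mset_sum_list)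
    with pk sk show kS: "?\<kappa> \<in> ?S" by (simp add: partitions_iff)
    show "remove1 r ?\<kappa> = \<mu>"
    proof (rule partition_unique)
      show "is_partition \<mu>" using \<mu> by (simp add: partitions_iff)
      show "mset (remove1 r ?\<kappa>) = mset \<mu>" using k by simp
      show "is_partition (remove1 r ?\<kappa>)"
        by (rule is_partition_remove1[OF pk])
    qed
    have "psum_part (r # \<mu>) = psum_part ?\<kappa>" by (rule psum_part_cong) (simp add: mset_partition_of_mset)
    moreover have "1 / zee \<mu> = of_nat (r * count_list ?\<kappa> r) / zee ?\<kappa>"
      using zee_add_part[OF k] zee_nonzero[of ?\<kappa>] p0 kS by auto
    ultimately show "qscale (of_nat (r * count_list ?\<kappa> r) / zee ?\<kappa>) (psum_part ?\<kappa>)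
        = qscale (1 / zee \<mu>) (psum_part (r # \<mu>))" by simp
  qed
  also have "\<dots> = psum_combination m (\<lambda>\<kappa>. of_nat (r * count_list \<kappa> r) / zee \<kappa>)"
    unfolding psum_combination_def
    by (rule sum.mono_neutral_left)
      (auto simp: finite_partitions count_notin qscale.rep_eq zero_series.rep_eq intro!: series_eqI)
  finally show ?thesis .
qed

text \<open>
  Every monomial \<open>M\<close> of degree \<open>m\<close> occurs on the right once for each variable \<open>i\<close> and each \<open>r\<close>
  up to the exponent of \<open>i\<close>, so \<open>m\<close> times in total.
\<close>

lemma hsym_newton:
  assumes "m > 0"
  shows "of_nat m * hsym (int m) = (\<Sum>r \<in> {1..m}. psum r * hsym (int (m - r)))"
proof (rule series_eqI)
  fix M :: "nat multiset"
  have "coefficient (psum r * hsym (int (m - r))) M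
      = of_bool (size M = m) * of_nat (card {i. i \<in># M \<and> r \<le> count M i})" if r: "r \<in> {1..m}" for r
  proof -
    have "coefficient (hsym (int (m - r))) (M - replicate_mset r i) = of_bool (size M = m)"
      if "i \<in># M" "r \<le> count M i" for i
    proof -
      have "replicate_mset r i \<subseteq># M" using that by (simp add: count_le_replicate_mset_subset_eq)
      then have "size (M - replicate_mset r i) = size M - r" "r \<le> size M"
        using size_Diff_submset[of "replicate_mset r i" M] size_mset_mono[of "replicate_mset r i" M] by simp_all
      then show ?thesis using r by (auto simp: hsym.rep_eq)
    qed
    then have "(\<Sum>i | i \<in># M \<and> r \<le> count M i. coefficient (hsym (int (m - r))) (M - replicate_mset r i))
        = (\<Sum>i | i \<in># M \<and> r \<le> count M i. of_bool (size M = m))"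
      by (intro sum.cong) auto
    moreover have "r > 0" using r by simp
    ultimately show ?thesis by (simp only: coefficient_psum_times) simp
  qed
  then have "coefficient (\<Sum>r \<in> {1..m}. psum r * hsym (int (m - r))) M
      = of_bool (size M = m) * (\<Sum>r \<in> {1..m}. of_nat (card {i. i \<in># M \<and> r \<le> count M i}))"
    by (simp add: coefficient_sum sum_distrib_left)
  also have "(\<Sum>r \<in> {1..m}. rat_of_nat (card {i. i \<in># M \<and> r \<le> count M i})) = of_nat m" if "size M = m"
  proof -
    have "(\<Sum>r \<in> {1..m}. card {i. i \<in># M \<and> r \<le> count M i})
        = (\<Sum>r \<in> {1..m}. \<Sum>i \<in> {i \<in> set_mset M. r \<le> count M i}. 1)" by simp
    also have "\<dots> = (\<Sum>i \<in> set_mset M. \<Sum>r \<in> {r \<in> {1..m}. r \<le> count M i}. 1)"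
      by (rule sum.swap_restrict) simp_all
    also have "\<dots> = (\<Sum>i \<in> set_mset M. count M i)"
    proof (rule sum.cong[OF refl])
      fix i
      have "{r \<in> {1..m}. r \<le> count M i} = {1..count M i}" using count_le_size[of M i] that by auto
      then show "(\<Sum>r \<in> {r \<in> {1..m}. r \<le> count M i}. 1) = count M i" by simp
    qed
    finally show ?thesis using that by (metis of_nat_sum size_multiset_overloaded_eq)
  qed
  then have "of_bool (size M = m) * (\<Sum>r \<in> {1..m}. rat_of_nat (card {i. i \<in># M \<and> r \<le> count M i}))
      = of_bool (size M = m) * of_nat m" by simp
  finally show "coefficient (of_nat m * hsym (int m)) M = coefficient (\<Sum>r \<in> {1..m}. psum r * hsym (int (m - r))) M"
    by (simp add: coefficient_of_nat_times hsym.rep_eq)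
qed

lemma sum_list_count_parts:
  assumes "sum_list \<kappa> = m"
  shows "(\<Sum>r \<in> {1..m}. r * count_list \<kappa> r) = m"
proof -
  have "(\<Sum>r \<in> {1..m}. r * count_list \<kappa> r) = (\<Sum>r \<in> set \<kappa>. r * count_list \<kappa> r)"
    by (rule sum.mono_neutral_cong) (use assms member_le_sum_list[of _ \<kappa>] in \<open>auto simp: count_notin\<close>)
  also have "\<dots> = m" using sum_list_map_eq_sum_count[of id \<kappa>] assms by (simp add: mult.commute)
  finally show ?thesis .
qed

lemma hsym_eq_psum_combination: "hsym (int m) = psum_combination m (\<lambda>\<kappa>. 1 / zee \<kappa>)"
proof (induction m rule: less_induct)
  case (less m)
  show ?case
  proof (cases "m = 0")
    case True
    have "partitions 0 = {[]}" by (auto simp: partitions_iff is_partition_def) (metis list.set_intros(1) neq_Nil_conv)+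
    then show ?thesis using True
      by (intro series_eqI) (simp add: coefficient_psum_combination zee_def psum_part_simps one_series.rep_eq hsym.rep_eq)
  next
    case False
    then have "of_nat m * hsym (int m) = (\<Sum>r \<in> {1..m}. psum r * hsym (int (m - r)))" by (intro hsym_newton) simp
    also have "\<dots> = (\<Sum>r \<in> {1..m}. psum_combination m (\<lambda>\<kappa>. of_nat (r * count_list \<kappa> r) / zee \<kappa>))"
    proof (rule sum.cong[OF refl])
      fix r assume "r \<in> {1..m}"
      then have r: "m - r < m" "0 < r" "r \<le> m" by auto
      show "psum r * hsym (int (m - r)) = psum_combination m (\<lambda>\<kappa>. of_nat (r * count_list \<kappa> r) / zee \<kappa>)"
        unfolding less.IH[OF r(1)] by (rule psum_times_inverse_zee[OF r(2,3)])
    qed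
    also have "\<dots> = of_nat m * psum_combination m (\<lambda>\<kappa>. 1 / zee \<kappa>)"
    proof (rule series_eqI)
      fix M
      have "(\<Sum>r \<in> {1..m}. \<Sum>\<kappa> \<in> partitions m. of_nat (r * count_list \<kappa> r) / zee \<kappa> * coefficient (psum_part \<kappa>) M)
          = (\<Sum>\<kappa> \<in> partitions m. of_nat (\<Sum>r \<in> {1..m}. r * count_list \<kappa> r) / zee \<kappa> * coefficient (psum_part \<kappa>) M)"
        unfolding of_nat_sum sum_divide_distrib sum_distrib_right by (rule sum.swap)
      also have "\<dots> = (\<Sum>\<kappa> \<in> partitions m. of_nat m / zee \<kappa> * coefficient (psum_part \<kappa>) M)"
        by (intro sum.cong refl) (simp only: sum_list_count_parts partitions_iff)
      finally show "coefficient (\<Sum>r \<in> {1..m}. psum_combination m (\<lambda>\<kappa>. of_nat (r * count_list \<kappa> r) / zee \<kappa>)) M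
          = coefficient (of_nat m * psum_combination m (\<lambda>\<kappa>. 1 / zee \<kappa>)) M"
        by (simp add: coefficient_sum coefficient_of_nat_times coefficient_psum_combination sum_distrib_left)
    qed
    finally have eq: "of_nat m * hsym (int m) = of_nat m * psum_combination m (\<lambda>\<kappa>. 1 / zee \<kappa>)" .
    show ?thesis
    proof (rule series_eqI)
      fix M
      show "coefficient (hsym (int m)) M = coefficient (psum_combination m (\<lambda>\<kappa>. 1 / zee \<kappa>)) M"
        using arg_cong[OF eq, of "\<lambda>f. coefficient f M"] False by (simp add: coefficient_of_nat_times)
    qed
  qed
qed

lemma psum_one_times_hsym:
  "psum 1 * hsym (int m - 1) = psum_combination m (\<lambda>\<kappa>. of_nat (count_list \<kappa> 1) / zee \<kappa>)"
proof (cases m)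
  case 0
  have "hsym (- 1) = 0" by (rule series_eqI) (simp add: hsym.rep_eq zero_series.rep_eq)
  moreover have "psum_combination 0 (\<lambda>\<kappa>. of_nat (count_list \<kappa> 1) / zee \<kappa>) = 0"
  proof (rule series_eqI)
    fix M
    have "count_list \<kappa> 1 = 0" if "\<kappa> \<in> partitions 0" for \<kappa>
      using that by (auto simp: partitions_iff count_list_0_iff)
    then show "coefficient (psum_combination 0 (\<lambda>\<kappa>. of_nat (count_list \<kappa> 1) / zee \<kappa>)) M = coefficient 0 M"
      by (simp add: coefficient_psum_combination zero_series.rep_eq)
  qed
  ultimately show ?thesis using 0 by simp
next
  case (Suc m')
  then show ?thesis using psum_times_inverse_zee[of 1 m] hsym_eq_psum_combination[of m'] by simp
qed

text \<open>
  The factor \<open>zee\<close> in the Kronecker product cancels the one in the expansions of $h_m$ and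
  $h_{m-1} h_1$.  The hypothesis on \<open>g\<close> says that it is the derivative of \<open>f\<close> by \<open>psum 1\<close>.
\<close>

lemma kronecker_hook:
  assumes "symmetric f" "homogeneous m f"
    and fresh: "\<And>M. \<exists>N. N \<notin># M \<and> coefficient f (add_mset N M) = coefficient g M"
  shows "kronecker f (psum 1 * hsym (int m - 1) - hsym (int m)) = psum 1 * g - f"
proof -
  obtain c where c: "f = psum_combination m c" using symmetric_eq_combination[OF assms(1,2)] .
  have diff: "psum_combination m a - psum_combination m b = psum_combination m (\<lambda>\<kappa>. a \<kappa> - b \<kappa>)" for a b
    by (rule series_eqI) (simp add: minus_series.rep_eq coefficient_psum_combination left_diff_distrib sum_subtractf)
  have cong: "psum_combination m a = psum_combination m b" if "\<And>\<kappa>. \<kappa> \<in> partitions m \<Longrightarrow> a \<kappa> = b \<kappa>" for a b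
    unfolding psum_combination_def using that by (auto intro: sum.cong)
  have z: "zee \<kappa> \<noteq> 0" if "\<kappa> \<in> partitions m" for \<kappa>
    using that zee_nonzero by (simp add: partitions_iff is_partition_def)
  have "kronecker f (psum 1 * hsym (int m - 1) - hsym (int m))
      = psum_combination m (\<lambda>\<kappa>. c \<kappa> * (of_nat (count_list \<kappa> 1) / zee \<kappa> - 1 / zee \<kappa>) * zee \<kappa>)"
    unfolding c psum_one_times_hsym hsym_eq_psum_combination diff kronecker_combination ..
  also have "\<dots> = psum_combination m (\<lambda>\<kappa>. of_nat (count_list \<kappa> 1) * c \<kappa> - c \<kappa>)"
    by (rule cong) (use z in \<open>simp add: field_simps\<close>)
  also have "\<dots> = psum 1 * g - f"
    unfolding diff[symmetric] c using psum_one_times_fresh[of m c g] fresh c by simp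
  finally show ?thesis .
qed

lemma jacobi_trudi_hook: "jacobi_trudi [x, 1] = psum 1 * hsym x - hsym (x + 1)"
proof -
  have 0: "hsym 0 = 1" by (rule series_eqI) (simp add: hsym.rep_eq one_series.rep_eq)
  have "size M = 1 \<longleftrightarrow> (\<exists>i. M = {#i#})" for M :: "nat multiset" using size_1_singleton_mset by auto
  then have 1: "hsym 1 = psum 1" by (intro series_eqI) (simp add: hsym.rep_eq psum.rep_eq)
  let ?t = "Transposition.transpose 0 1 :: nat \<Rightarrow> nat"
  have "{0..<Suc (Suc 0)} = {0, 1 :: nat}" by auto
  then have "{p. p permutes {0..<Suc (Suc 0)}} = {id, ?t}" by (auto simp: permutes_doubleton_iff)
  moreover have "id \<noteq> ?t" by (metis id_apply transpose_apply_first zero_neq_one)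
  ultimately show ?thesis unfolding jacobi_trudi_def
    by (simp add: det_def 0 1 sign_swap_id sign_id mult.commute)
qed

section \<open>Skew Schur functions of shapes\<close>

definition shape_schur :: "(nat \<Rightarrow> nat) \<Rightarrow> (nat \<Rightarrow> nat) \<Rightarrow> series" where
  "shape_schur g f = (if f \<le> g then tableau_series (boxes g - boxes f) else 0)"

text \<open>
  The strip sizes of the chain that belongs to a tableau with content \<open>M\<close> and entries below \<open>N\<close>.
\<close>

definition content_list :: "nat multiset \<Rightarrow> nat \<Rightarrow> nat list" where
  "content_list M N = map (count M) [0..<N]"

lemma coefficient_shape_schur:
  assumes "shape f" "shape g" "set_mset M \<subseteq> {..<N}"
  shows "coefficient (shape_schur g f) M = of_nat (chains (content_list M N) f g)"
proof (cases "f \<le> g")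
  case True
  have "coefficient (shape_schur g f) M = of_nat (card (tableaux (boxes g - boxes f) M))"
    using True by (simp add: shape_schur_def tableau_series.rep_eq tableaux_def)
  also have "card (tableaux (boxes g - boxes f) M) = chains (content_list M N) f g"
    using card_tableaux_eq_chains[OF assms(1,2) True, of M 0 N] assms(3)
    by (simp add: content_list_def lessThan_atLeast0)
  finally show ?thesis .
next
  case False
  then have "chains (content_list M N) f g = 0" using chains_nonzero assms(1) by blast
  then show ?thesis using False by (simp add: shape_schur_def zero_series.rep_eq)
qed

lemma bounded_variables: "\<exists>N. set_mset M \<subseteq> {..<N :: nat}"
  using finite_nat_iff_bounded by blast

lemma mset_content_list:
  assumes "set_mset M \<subseteq> {..<N}"
  shows "mset (content_list M N) = exponents M + replicate_mset (N - size (exponents M)) 0"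
proof -
  have "mset (content_list M N) = image_mset (count M) (mset_set {..<N})"
    by (simp add: content_list_def lessThan_atLeast0)
  also have "{..<N} = set_mset M \<union> ({..<N} - set_mset M)" using assms by blast
  also have "mset_set \<dots> = mset_set (set_mset M) + mset_set ({..<N} - set_mset M)"
    by (rule mset_set_Union) auto
  also have "image_mset (count M) (mset_set ({..<N} - set_mset M)) = image_mset (\<lambda>_. 0) (mset_set ({..<N} - set_mset M))"
    by (rule image_mset_cong) (simp add: count_eq_zero_iff)
  then have "image_mset (count M) (mset_set (set_mset M) + mset_set ({..<N} - set_mset M))
      = exponents M + image_mset (\<lambda>_. 0) (mset_set ({..<N} - set_mset M))"
    by (simp add: exponents_def)
  also have "image_mset (\<lambda>_. 0) (mset_set ({..<N} - set_mset M)) = replicate_mset (N - size (exponents M)) (0 :: nat)"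
    using assms by (simp add: image_mset_const_eq size_exponents card_Diff_subset)
  finally show ?thesis .
qed

text \<open>
  Equal exponents give strip sizes that differ only in their order.
\<close>

lemma symmetric_shape_schur:
  assumes "shape f" "shape g" shows "symmetric (shape_schur g f)"
  unfolding symmetric_def
proof (intro allI impI)
  fix M M' assume e: "exponents M = exponents M'"
  obtain N where "set_mset (M + M') \<subseteq> {..<N}" using bounded_variables by blast
  then have N: "set_mset M \<subseteq> {..<N}" "set_mset M' \<subseteq> {..<N}" by auto
  have "mset (content_list M N) = mset (content_list M' N)"
    using mset_content_list[OF N(1)] mset_content_list[OF N(2)] e by simp
  from chains_perm[OF assms(1) this]
  show "coefficient (shape_schur g f) M = coefficient (shape_schur g f) M'"
    using coefficient_shape_schur[OF assms N(1)] coefficient_shape_schur[OF assms N(2)] by simp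
qed

lemma homogeneous_shape_schur:
  assumes "shape f" "shape g" shows "homogeneous (card (boxes g) - card (boxes f)) (shape_schur g f)"
  unfolding homogeneous_def
proof (intro allI impI)
  fix M assume nz: "coefficient (shape_schur g f) M \<noteq> 0"
  obtain N where N: "set_mset M \<subseteq> {..<N}" using bounded_variables by blast
  have "chains (content_list M N) f g \<noteq> 0" using nz coefficient_shape_schur[OF assms N] by auto
  from chains_nonzero[OF this assms(1)] 
  have "card (boxes g) = card (boxes f) + sum_list (content_list M N)" by simp
  moreover have "sum_list (content_list M N) = size M"
    using arg_cong[OF mset_content_list[OF N], of sum_mset]
    unfolding sum_mset_sum_list by (simp add: sum_exponents)
  ultimately show "size M = card (boxes g) - card (boxes f)" by simp
qed

lemma content_list_add_fresh:
  assumes "set_mset M \<subseteq> {..<N}"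
  shows "content_list (add_mset N M) (Suc N) = content_list M N @ [1]"
proof -
  have "count M N = 0" using assms by (auto simp: count_eq_zero_iff)
  then show ?thesis by (auto simp: content_list_def)
qed

text \<open>
  Here \<open>N\<close> is larger than all other entries, so it is the last strip of the chain.
\<close>

lemma shape_schur_fresh_remove:
  assumes "shape f" "shape g" "set_mset M \<subseteq> {..<N}"
  shows "coefficient (shape_schur g f) (add_mset N M)
       = coefficient (\<Sum>e \<in> remove_box g. shape_schur e f) M"
proof -
  have "set_mset (add_mset N M) \<subseteq> {..<Suc N}" using assms(3) by auto
  from coefficient_shape_schur[OF assms(1,2) this]
  have "coefficient (shape_schur g f) (add_mset N M) = of_nat (\<Sum>e \<in> remove_box g. chains (content_list M N) f e)"
    unfolding content_list_add_fresh[OF assms(3)] chains_snoc_one[OF assms(1,2)] .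
  also have "\<dots> = coefficient (\<Sum>e \<in> remove_box g. shape_schur e f) M"
    by (simp add: coefficient_sum coefficient_shape_schur[OF assms(1) shape_remove_box assms(3)])
  finally show ?thesis .
qed

lemma shape_add_box: "e \<in> add_box f \<Longrightarrow> shape e"
  by (simp add: add_box_def)

text \<open>
  By symmetry the strip of size one that belongs to \<open>N\<close> may also be taken as the first of the chain.
\<close>

lemma shape_schur_fresh_add:
  assumes "shape f" "shape g" "set_mset M \<subseteq> {..<N}"
  shows "coefficient (shape_schur g f) (add_mset N M)
       = coefficient (\<Sum>e \<in> add_box f. shape_schur g e) M"
proof -
  have "set_mset (add_mset N M) \<subseteq> {..<Suc N}" using assms(3) by auto
  from coefficient_shape_schur[OF assms(1,2) this]
  have "coefficient (shape_schur g f) (add_mset N M) = of_nat (chains (content_list M N @ [1]) f g)"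
    unfolding content_list_add_fresh[OF assms(3)] .
  also have "chains (content_list M N @ [1]) f g = chains (1 # content_list M N) f g"
    by (rule chains_perm[OF assms(1)]) simp
  also have "\<dots> = (\<Sum>e \<in> add_box f. chains (content_list M N) e g)"
    by (simp add: add_box_iff_strip[OF assms(1)])
  also have "of_nat \<dots> = coefficient (\<Sum>e \<in> add_box f. shape_schur g e) M"
    by (simp add: coefficient_sum coefficient_shape_schur[OF shape_add_box assms(2) assms(3)])
  finally show ?thesis .
qed

lemma sum_remove_outer_eq_sum_add_inner:
  assumes "shape f" "shape g"
  shows "(\<Sum>e \<in> remove_box g. shape_schur e f) = (\<Sum>e \<in> add_box f. shape_schur g e)"
proof (rule series_eqI)
  fix M :: "nat multiset"
  obtain N where N: "set_mset M \<subseteq> {..<N}" using bounded_variables by blast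
  show "coefficient (\<Sum>e \<in> remove_box g. shape_schur e f) M = coefficient (\<Sum>e \<in> add_box f. shape_schur g e) M"
    unfolding shape_schur_fresh_remove[OF assms N, symmetric] by (rule shape_schur_fresh_add[OF assms N])
qed

text \<open>
  The product with \<open>psum 1\<close> sums the coefficients over all ways to lower one exponent, that is, to take
  one box away from one strip; these are the correction terms in \<open>chains_pieri\<close>.
\<close>

lemma skew_pieri:
  assumes "shape f" "shape g"
  shows "psum 1 * shape_schur g f
       = (\<Sum>h \<in> add_box g. shape_schur h f) - (\<Sum>e \<in> remove_box f. shape_schur g e)"
proof (rule series_eqI)
  fix M :: "nat multiset"
  obtain N where N: "set_mset M \<subseteq> {..<N}" using bounded_variables by blast
  let ?a = "content_list M N"
  have len: "length ?a = N" by (simp add: content_list_def)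
  have nth: "?a ! i = count M i" if "i < N" for i using that by (simp add: content_list_def)
  have upd: "?a[i := ?a ! i - 1] = content_list (M - {#i#}) N" if "i < N" for i
    using that by (intro nth_equalityI) (auto simp: content_list_def nth_list_update)
  have "coefficient (psum 1 * shape_schur g f) M = (\<Sum>i \<in> {i \<in> {..<N}. count M i > 0}. coefficient (shape_schur g f) (M - {#i#}))"
    by (subst coefficient_psum_times) (use N in \<open>auto intro!: sum.cong\<close>)
  also have "\<dots> = (\<Sum>i \<in> {i \<in> {..<N}. count M i > 0}. of_nat (chains (?a[i := ?a ! i - 1]) f g))"
  proof (rule sum.cong[OF refl])
    fix i assume i: "i \<in> {i \<in> {..<N}. count M i > 0}"
    have "set_mset (M - {#i#}) \<subseteq> {..<N}" using N by (auto dest: in_diffD)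
    from coefficient_shape_schur[OF assms this]
    show "coefficient (shape_schur g f) (M - {#i#}) = of_nat (chains (?a[i := ?a ! i - 1]) f g)"
      using upd i by simp
  qed
  also have "\<dots> = of_nat (\<Sum>i<length ?a. if ?a ! i > 0 then chains (?a[i := ?a ! i - 1]) f g else 0)"
    unfolding of_nat_sum len by (subst sum.inter_filter) (auto simp: nth intro!: sum.cong)
  also have "\<dots> = of_nat (\<Sum>h \<in> add_box g. chains ?a f h) - of_nat (\<Sum>e \<in> remove_box f. chains ?a e g)"
    unfolding chains_pieri[OF assms] by simp
  also have "\<dots> = coefficient ((\<Sum>h \<in> add_box g. shape_schur h f) - (\<Sum>e \<in> remove_box f. shape_schur g e)) M"
    by (simp add: minus_series.rep_eq coefficient_sum
        coefficient_shape_schur[OF assms(1) shape_add_box N] coefficient_shape_schur[OF shape_remove_box assms(2) N])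
  finally show "coefficient (psum 1 * shape_schur g f) M
      = coefficient ((\<Sum>h \<in> add_box g. shape_schur h f) - (\<Sum>e \<in> remove_box f. shape_schur g e)) M" .
qed

definition moved_box :: "(nat \<Rightarrow> nat) \<Rightarrow> (nat \<Rightarrow> nat) set" where
  "moved_box g = (\<Union>f \<in> remove_box g. add_box f) - {g}"

text \<open>
  Every intermediate shape \<open>f\<close> leads back to \<open>g\<close>.  Any other shape \<open>h\<close> is reached through one
  intermediate shape only, the intersection of \<open>g\<close> and \<open>h\<close>.
\<close>

lemma sum_remove_add_box:
  fixes F :: "(nat \<Rightarrow> nat) \<Rightarrow> series"
  assumes g: "shape g"
  shows "(\<Sum>f \<in> remove_box g. \<Sum>h \<in> add_box f. F h)
       = of_nat (card (remove_box g)) * F g + (\<Sum>h \<in> moved_box g. F h)"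
proof -
  have fin: "finite (add_box f)" if "f \<in> remove_box g" for f using that finite_add_box shape_remove_box by blast
  have "(\<Sum>f \<in> remove_box g. \<Sum>h \<in> add_box f. F h) = (\<Sum>f \<in> remove_box g. F g + (\<Sum>h \<in> add_box f - {g}. F h))"
  proof (rule sum.cong[OF refl])
    fix f assume f: "f \<in> remove_box g"
    then have "g \<in> add_box f" using g by (auto simp: remove_box_def add_box_def)
    then show "(\<Sum>h \<in> add_box f. F h) = F g + (\<Sum>h \<in> add_box f - {g}. F h)" by (rule sum.remove[OF fin[OF f]])
  qed
  also have "\<dots> = of_nat (card (remove_box g)) * F g + (\<Sum>f \<in> remove_box g. \<Sum>h \<in> add_box f - {g}. F h)"
    by (simp add: sum.distrib)
  also have "(\<Sum>f \<in> remove_box g. \<Sum>h \<in> add_box f - {g}. F h) = (\<Sum>h \<in> (\<Union>f \<in> remove_box g. add_box f - {g}). F h)"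
  proof (rule sum.UNION_disjoint[symmetric])
    \<comment> \<open>The boxes added to \<open>f\<close> on the way to \<open>g\<close> and to \<open>h\<close> lie in different rows.\<close>
    have min: "f = (\<lambda>i. min (g i) (h i))" if "f \<in> remove_box g" "h \<in> add_box f" "h \<noteq> g" for f h
    proof -
      from that obtain r s where "g = f(r := Suc (f r))" "h = f(s := Suc (f s))"
        by (auto simp: remove_box_def add_box_def)
      moreover from this that(3) have "r \<noteq> s" by auto
      ultimately show ?thesis by auto
    qed
    show "\<forall>f \<in> remove_box g. \<forall>f' \<in> remove_box g. f \<noteq> f' \<longrightarrow> (add_box f - {g}) \<inter> (add_box f' - {g}) = {}"
      using min by blast
  qed (use finite_remove_box[OF g] fin in auto)
  also have "(\<Union>f \<in> remove_box g. add_box f - {g}) = moved_box g" by (auto simp: moved_box_def)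
  finally show ?thesis .
qed

lemma kronecker_shape_schur:
  assumes f: "shape f" and g: "shape g" and m: "m = card (boxes g) - card (boxes f)"
  shows "kronecker (shape_schur g f) (psum 1 * hsym (int m - 1) - hsym (int m))
       = of_int (int (card (remove_box g)) - int (card (remove_box f)) - 1) * shape_schur g f
         + (\<Sum>h \<in> moved_box g. shape_schur h f) - (\<Sum>e \<in> moved_box f. shape_schur g e)"
proof -
  let ?s = shape_schur
  have "kronecker (?s g f) (psum 1 * hsym (int m - 1) - hsym (int m))
      = psum 1 * (\<Sum>e \<in> remove_box g. ?s e f) - ?s g f"
  proof (rule kronecker_hook[OF symmetric_shape_schur[OF f g]])
    show "homogeneous m (?s g f)" unfolding m by (rule homogeneous_shape_schur[OF f g])
    fix M :: "nat multiset"
    obtain N where N: "set_mset M \<subseteq> {..<N}" using bounded_variables by blast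
    then have "N \<notin># M" by auto
    with shape_schur_fresh_remove[OF f g N]
    show "\<exists>N. N \<notin># M \<and> coefficient (?s g f) (add_mset N M) = coefficient (\<Sum>e \<in> remove_box g. ?s e f) M" by blast
  qed
  also have "psum 1 * (\<Sum>e \<in> remove_box g. ?s e f)
      = (\<Sum>e \<in> remove_box g. (\<Sum>h \<in> add_box e. ?s h f) - (\<Sum>d \<in> remove_box f. ?s e d))"
    unfolding sum_distrib_left by (intro sum.cong refl skew_pieri f shape_remove_box)
  also have "\<dots> = (\<Sum>e \<in> remove_box g. \<Sum>h \<in> add_box e. ?s h f) - (\<Sum>d \<in> remove_box f. \<Sum>e \<in> remove_box g. ?s e d)"
    unfolding sum_subtractf by (subst (2) sum.swap) simp
  also have "(\<Sum>d \<in> remove_box f. \<Sum>e \<in> remove_box g. ?s e d) = (\<Sum>d \<in> remove_box f. \<Sum>e \<in> add_box d. ?s g e)"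
    by (intro sum.cong refl sum_remove_outer_eq_sum_add_inner g shape_remove_box)
  finally show ?thesis
    unfolding sum_remove_add_box[OF f] sum_remove_add_box[OF g] by (simp add: algebra_simps)
qed

section \<open>Partitions as shapes\<close>

definition row_lengths :: "nat list \<Rightarrow> nat \<Rightarrow> nat" where
  "row_lengths \<alpha> i = (if i < length \<alpha> then \<alpha> ! i else 0)"

lemma diagram_eq_boxes: "diagram \<alpha> = boxes (row_lengths \<alpha>)"
  by (auto simp: diagram_def boxes_def row_lengths_def split: if_splits)

lemma shape_row_lengths:
  assumes "is_partition \<alpha>" shows "shape (row_lengths \<alpha>)"
proof -
  have "row_lengths \<alpha> j \<le> row_lengths \<alpha> i" if "i \<le> j" for i j
    using assms that unfolding row_lengths_def is_partition_def
    by (cases "i = j") (auto simp: sorted_wrt_iff_nth_less)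
  moreover have "row_lengths \<alpha> (length \<alpha>) = 0" by (simp add: row_lengths_def)
  ultimately show ?thesis by (auto simp: shape_def decseq_def)
qed

lemma row_lengths_inject:
  assumes "is_partition \<alpha>" "is_partition \<beta>" "row_lengths \<alpha> = row_lengths \<beta>" shows "\<alpha> = \<beta>"
proof -
  have pos: "i < length \<alpha> \<longleftrightarrow> row_lengths \<alpha> i > 0" if "is_partition \<alpha>" for \<alpha> i
  proof (cases "i < length \<alpha>")
    case True
    then have "\<alpha> ! i \<noteq> 0" using that nth_mem[OF True] unfolding is_partition_def by metis
    then show ?thesis using True by (simp add: row_lengths_def)
  qed (simp add: row_lengths_def)
  have "i < length \<alpha> \<longleftrightarrow> i < length \<beta>" for i using pos assms by simp
  then have len: "length \<alpha> = length \<beta>" by (metis linorder_neqE_nat order_less_irrefl)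
  show ?thesis
  proof (rule nth_equalityI[OF len])
    fix i assume "i < length \<alpha>"
    then show "\<alpha> ! i = \<beta> ! i" using fun_cong[OF assms(3), of i] len by (simp add: row_lengths_def)
  qed
qed

lemma row_lengths_surj:
  assumes "shape f" shows "\<exists>\<alpha>. is_partition \<alpha> \<and> row_lengths \<alpha> = f"
proof -
  define n where "n = (LEAST n. f n = 0)"
  have "\<exists>n. f n = 0" using assms by (auto simp: shape_def)
  then have n: "f n = 0" unfolding n_def by (rule LeastI_ex)
  have less: "f i > 0" if "i < n" for i using not_less_Least[of i "\<lambda>n. f n = 0"] that by (auto simp: n_def)
  have d: "f j \<le> f i" if "i \<le> j" for i j using assms that by (simp add: shape_def decseqD)
  let ?\<alpha> = "map f [0..<n]"
  have "0 \<notin> set ?\<alpha>"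
  proof
    assume "0 \<in> set ?\<alpha>"
    then obtain i where "i < n" "f i = 0" by auto
    with less[of i] show False by simp
  qed
  then have "is_partition ?\<alpha>" using d by (simp add: is_partition_def sorted_wrt_iff_nth_less)
  moreover have "row_lengths ?\<alpha> = f"
  proof
    fix i show "row_lengths ?\<alpha> i = f i" using d[of n i] n by (auto simp: row_lengths_def)
  qed
  ultimately show ?thesis by blast
qed

lemma card_boxes_row_lengths: "card (boxes (row_lengths \<alpha>)) = sum_list \<alpha>"
proof -
  have "card (boxes (row_lengths \<alpha>)) = (\<Sum>i<length \<alpha>. row_lengths \<alpha> i)" by (rule card_boxes) (simp add: row_lengths_def)
  also have "\<dots> = (\<Sum>i<length \<alpha>. \<alpha> ! i)" by (rule sum.cong) (simp_all add: row_lengths_def)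
  finally show ?thesis by (simp add: sum_list_sum_nth lessThan_atLeast0)
qed

lemma skew_schur_eq_shape_schur: "skew_schur \<alpha> \<theta> = shape_schur (row_lengths \<alpha>) (row_lengths \<theta>)"
  by (simp add: skew_schur_def shape_schur_def diagram_eq_boxes boxes_mono_iff)

lemma boxes_inject: "boxes f = boxes g \<longleftrightarrow> f = g"
  by (metis boxes_mono_iff order_antisym order_refl)

lemma insert_box_iff:
  assumes f: "shape f" and g: "shape g"
  shows "(\<exists>d. d \<notin> boxes f \<and> boxes g = insert d (boxes f)) \<longleftrightarrow> (\<exists>r. g = f(r := Suc (f r)))"
proof
  assume "\<exists>d. d \<notin> boxes f \<and> boxes g = insert d (boxes f)"
  then obtain d where d: "d \<notin> boxes f" "boxes g = insert d (boxes f)" by blast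
  have "f \<le> g" unfolding boxes_mono_iff[symmetric] d(2) by (rule subset_insertI)
  moreover have "card (boxes g) = Suc (card (boxes f))" using d finite_boxes[OF f] by simp
  ultimately obtain r where "g = f(r := Suc (f r))" by (rule grown_by_one[OF f g])
  then show "\<exists>r. g = f(r := Suc (f r))" by blast
next
  assume "\<exists>r. g = f(r := Suc (f r))"
  then obtain r where r: "g = f(r := Suc (f r))" by blast
  have "(r, f r) \<notin> boxes f" "boxes g = insert (r, f r) (boxes f)"
    unfolding r by (auto simp: boxes_def split: if_splits)
  then show "\<exists>d. d \<notin> boxes f \<and> boxes g = insert d (boxes f)" by blast
qed

lemma delete_box_iff:
  assumes f: "shape f" and g: "shape g"
  shows "(\<exists>c \<in> boxes g. boxes f = boxes g - {c}) \<longleftrightarrow> f \<in> remove_box g"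
proof -
  have "(\<exists>c \<in> boxes g. boxes f = boxes g - {c}) \<longleftrightarrow> (\<exists>d. d \<notin> boxes f \<and> boxes g = insert d (boxes f))" by auto
  then show ?thesis unfolding insert_box_iff[OF f g] using f by (simp only: remove_box_def mem_Collect_eq simp_thms)
qed

lemma card_corners:
  assumes "is_partition \<alpha>" shows "card (corners \<alpha>) = card (remove_box (row_lengths \<alpha>))"
proof -
  let ?g = "row_lengths \<alpha>" and ?d = "\<lambda>c. boxes (row_lengths \<alpha>) - {c}"
  note g = shape_row_lengths[OF assms]
  have c: "corners \<alpha> = {c \<in> boxes ?g. \<exists>f. shape f \<and> boxes f = ?d c}"
  proof -
    have "(\<exists>\<gamma>. is_partition \<gamma> \<and> boxes (row_lengths \<gamma>) = X) \<longleftrightarrow> (\<exists>f. shape f \<and> boxes f = X)" for X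
      using shape_row_lengths row_lengths_surj by blast
    then show ?thesis by (simp only: corners_def diagram_eq_boxes)
  qed
  have "?d ` corners \<alpha> = boxes ` remove_box ?g"
  proof (intro equalityI subsetI)
    fix X assume "X \<in> ?d ` corners \<alpha>"
    then obtain c f where "c \<in> boxes ?g" "shape f" "boxes f = ?d c" "X = ?d c" unfolding c by blast
    then show "X \<in> boxes ` remove_box ?g" using delete_box_iff[OF _ g] by blast
  next
    fix X assume "X \<in> boxes ` remove_box ?g"
    then obtain f where f: "f \<in> remove_box ?g" "X = boxes f" by blast
    then have "\<exists>c \<in> boxes ?g. boxes f = ?d c" using delete_box_iff[OF shape_remove_box[OF f(1)] g] by blast
    then show "X \<in> ?d ` corners \<alpha>" using f shape_remove_box unfolding c by blast
  qed
  moreover have "card (?d ` corners \<alpha>) = card (corners \<alpha>)"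
    by (rule card_image) (auto simp: inj_on_def c)
  moreover have "card (boxes ` remove_box ?g) = card (remove_box ?g)"
    by (rule card_image) (auto simp: inj_on_def boxes_inject)
  ultimately show ?thesis by simp
qed

lemma row_lengths_move_box:
  assumes "is_partition \<alpha>" shows "row_lengths ` move_box \<alpha> = moved_box (row_lengths \<alpha>)"
proof -
  note g = shape_row_lengths[OF assms]
  have add: "(\<exists>d. d \<notin> diagram \<gamma> \<and> diagram \<beta> = insert d (diagram \<gamma>)) \<longleftrightarrow> row_lengths \<beta> \<in> add_box (row_lengths \<gamma>)"
    if "is_partition \<beta>" "is_partition \<gamma>" for \<beta> \<gamma>
    unfolding diagram_eq_boxes insert_box_iff[OF shape_row_lengths[OF that(2)] shape_row_lengths[OF that(1)]]
    using shape_row_lengths[OF that(1)] by (simp add: add_box_def)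
  have del: "(\<exists>c \<in> corners \<alpha>. diagram \<gamma> = diagram \<alpha> - {c}) \<longleftrightarrow> row_lengths \<gamma> \<in> remove_box (row_lengths \<alpha>)"
    if "is_partition \<gamma>" for \<gamma>
    unfolding delete_box_iff[OF shape_row_lengths[OF that] g, symmetric]
    using that by (auto simp: corners_def diagram_eq_boxes)
  have ex: "(\<exists>\<gamma>. is_partition \<gamma> \<and> row_lengths \<gamma> \<in> remove_box g \<and> h \<in> add_box (row_lengths \<gamma>)) \<longleftrightarrow> (\<exists>f \<in> remove_box g. h \<in> add_box f)" for g h
  proof
    assume "\<exists>f \<in> remove_box g. h \<in> add_box f"
    then obtain f where f: "f \<in> remove_box g" "h \<in> add_box f" by blast
    obtain \<gamma> where "is_partition \<gamma>" "row_lengths \<gamma> = f" using row_lengths_surj[OF shape_remove_box[OF f(1)]] by blast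
    with f show "\<exists>\<gamma>. is_partition \<gamma> \<and> row_lengths \<gamma> \<in> remove_box g \<and> h \<in> add_box (row_lengths \<gamma>)" by blast
  qed blast
  have mb: "\<beta> \<in> move_box \<alpha> \<longleftrightarrow> is_partition \<beta> \<and> row_lengths \<beta> \<in> moved_box (row_lengths \<alpha>)" for \<beta>
  proof -
    have "\<beta> \<in> move_box \<alpha> \<longleftrightarrow> is_partition \<beta> \<and> \<beta> \<noteq> \<alpha> \<and>
        (\<exists>\<gamma>. is_partition \<gamma> \<and> row_lengths \<gamma> \<in> remove_box (row_lengths \<alpha>) \<and> row_lengths \<beta> \<in> add_box (row_lengths \<gamma>))"
      by (simp only: move_box_def mem_Collect_eq add del cong: conj_cong)
    also have "\<dots> \<longleftrightarrow> is_partition \<beta> \<and> row_lengths \<beta> \<noteq> row_lengths \<alpha> \<and> (\<exists>f \<in> remove_box (row_lengths \<alpha>). row_lengths \<beta> \<in> add_box f)"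
      unfolding ex using row_lengths_inject[OF _ assms, of \<beta>] by blast
    finally show ?thesis by (auto simp: moved_box_def)
  qed
  have "\<exists>\<beta>. is_partition \<beta> \<and> row_lengths \<beta> = h" if "h \<in> moved_box (row_lengths \<alpha>)" for h
    using that by (auto simp: moved_box_def intro: row_lengths_surj shape_add_box)
  then show ?thesis using mb by (auto simp: image_iff)
qed

lemma sum_move_box:
  assumes "is_partition \<alpha>"
  shows "(\<Sum>\<beta> \<in> move_box \<alpha>. F (row_lengths \<beta>)) = (\<Sum>h \<in> moved_box (row_lengths \<alpha>). F h)"
proof -
  have "inj_on row_lengths (move_box \<alpha>)" by (rule inj_onI) (auto simp: move_box_def intro: row_lengths_inject)
  from sum.reindex[OF this, of F] show ?thesis by (simp add: row_lengths_move_box[OF assms])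
qed

section \<open>Hook Schur functions\<close>

lemma row_lengths_singleton: "row_lengths [a] = (\<lambda>i. if i = 0 then a else 0)"
  by (auto simp: row_lengths_def)

lemma shape_single_row: "shape (\<lambda>i. if i = 0 then a else 0)"
  by (auto simp: shape_def decseq_def)

lemma card_boxes_single_row: "card (boxes (\<lambda>i. if i = 0 then a else 0)) = a"
  using card_boxes[of 1 "\<lambda>i. if i = 0 then a else 0"] by simp

text \<open>
  All shapes below a single row are single rows, so the strip sizes determine the chain.
\<close>

lemma chains_single_row:
  "chains as (\<lambda>i. if i = 0 then b else 0) (\<lambda>i. if i = 0 then a else 0) = of_bool (a = b + sum_list as)"
proof (induction as arbitrary: b)
  case Nil
  then show ?case by (auto simp: fun_eq_iff)
next
  case (Cons x as)
  let ?r = "\<lambda>a i. if i = (0 :: nat) then a else 0 :: nat"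
  have fin: "finite (strips x (?r b))" by (rule finite_strips[OF shape_single_row])
  have in_strips: "?r (b + x) \<in> strips x (?r b)"
    unfolding strips_def by (auto simp: hstrip_def card_boxes_single_row)
  have "chains as e (?r a) = 0" if e: "e \<in> strips x (?r b)" "e \<noteq> ?r (b + x)" for e
  proof (rule ccontr)
    assume "chains as e (?r a) \<noteq> 0"
    then have "e \<le> ?r a" using chains_nonzero shape_strips[OF shape_single_row e(1)] by blast
    then have "e i = 0" if "i > 0" for i using that by (auto simp: le_fun_def dest: spec[of _ i])
    then have e0: "e = ?r (e 0)" by auto
    have "card (boxes e) = b + x" using e(1) by (simp add: strips_def card_boxes_single_row)
    then have "e 0 = b + x" using e0 card_boxes_single_row[of "e 0"] by simp
    with e0 have "e = ?r (b + x)" by (simp only:)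
    with e(2) show False by (rule notE)
  qed
  then have "chains (x # as) (?r b) (?r a) = (\<Sum>e \<in> {?r (b + x)}. chains as e (?r a))"
    unfolding chains.simps by (intro sum.mono_neutral_right fin) (use in_strips in auto)
  then show ?case using Cons.IH[of "b + x"] by (simp add: add.assoc)
qed

lemma shape_schur_single_row: "shape_schur (row_lengths [a]) (row_lengths []) = hsym (int a)"
proof (rule series_eqI)
  fix M :: "nat multiset"
  obtain N where N: "set_mset M \<subseteq> {..<N}" using bounded_variables by blast
  have 0: "row_lengths [] = (\<lambda>i. if i = 0 then 0 else 0)" by (auto simp: row_lengths_def)
  have "sum_list (content_list M N) = size M"
    using arg_cong[OF mset_content_list[OF N], of sum_mset]
    unfolding sum_mset_sum_list by (simp add: sum_exponents)
  then show "coefficient (shape_schur (row_lengths [a]) (row_lengths [])) M = coefficient (hsym (int a)) M"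
    unfolding row_lengths_singleton 0 coefficient_shape_schur[OF shape_single_row shape_single_row N] chains_single_row
    by (auto simp: hsym.rep_eq)
qed

lemma add_box_single_row:
  assumes "a > 0" shows "add_box (row_lengths [a]) = {row_lengths [Suc a], row_lengths [a, 1]}"
proof (intro equalityI subsetI)
  fix g assume "g \<in> add_box (row_lengths [a])"
  then obtain r where r: "shape g" "g = (row_lengths [a])(r := Suc (row_lengths [a] r))" by (auto simp: add_box_def)
  have "r < 2"
  proof (rule ccontr)
    assume "\<not> r < 2"
    then have "g 1 = 0" "g r = 1" "1 \<le> r" using r(2) by (auto simp: row_lengths_def)
    then show False using r(1) decseqD[of g 1 r] by (simp add: shape_def)
  qed
  then have "r = 0 \<or> r = 1" by linarith
  then show "g \<in> {row_lengths [Suc a], row_lengths [a, 1]}" using r(2) by (auto simp: row_lengths_def fun_eq_iff less_Suc_eq)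
next
  fix g assume "g \<in> {row_lengths [Suc a], row_lengths [a, 1]}"
  moreover have "shape (row_lengths [Suc a])" "shape (row_lengths [a, 1])"
    using assms by (auto intro!: shape_row_lengths simp: is_partition_def)
  moreover have "row_lengths [Suc a] = (row_lengths [a])(0 := Suc (row_lengths [a] 0))" "row_lengths [a, 1] = (row_lengths [a])(1 := Suc (row_lengths [a] 1))"
    by (auto simp: row_lengths_def fun_eq_iff less_Suc_eq)
  ultimately show "g \<in> add_box (row_lengths [a])" unfolding add_box_def by blast
qed

text \<open>
  For \<open>m \<ge> 2\<close> this is the Pieri rule for a single row of length \<open>m - 1\<close>.  For smaller \<open>m\<close> the
  sequence is not a partition and the Jacobi--Trudi determinant itself is of this form.
\<close>

lemma schur_hook: "schur [int m - 1, 1] = psum 1 * hsym (int m - 1) - hsym (int m)"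
proof (cases "m \<ge> 2")
  case True
  define a where "a = m - 1"
  have a: "a > 0" "int m - 1 = int a" "int m = int (Suc a)" using True by (auto simp: a_def)
  have part: "is_partition [a, 1]" "is_partition [a]" using a(1) by (auto simp: is_partition_def)
  have "schur [int a, 1] = shape_schur (row_lengths [a, 1]) (row_lengths [])"
    unfolding schur_def skew_schur_eq_shape_schur using part(1) by (auto intro!: exI[of _ "[a, 1]"])
  moreover have "remove_box (row_lengths []) = {}" by (auto simp: remove_box_def row_lengths_def fun_eq_iff)
  moreover have "row_lengths [Suc a] \<noteq> row_lengths [a, 1]" by (auto simp: row_lengths_def fun_eq_iff intro: exI[of _ 0])
  moreover have "shape (row_lengths [])" "shape (row_lengths [a])" using part(2) by (auto intro!: shape_row_lengths simp: is_partition_def)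
  ultimately have "psum 1 * hsym (int a) = hsym (int (Suc a)) + schur [int a, 1]"
    using skew_pieri[of "row_lengths []" "row_lengths [a]"] add_box_single_row[OF a(1)]
    by (simp add: shape_schur_single_row)
  then show ?thesis unfolding a by simp
next
  case False
  then have "\<not> (\<exists>\<alpha>. is_partition \<alpha> \<and> [int m - 1, 1] = map int \<alpha>)"
    by (auto simp: is_partition_def Cons_eq_map_conv)
  then have "schur [int m - 1, 1] = jacobi_trudi [int m - 1, 1]" unfolding schur_def by (rule if_not_P)
  then show ?thesis by (simp add: jacobi_trudi_hook)
qed

theorem theorem6p1:
  fixes n k :: nat and \<alpha> \<theta> :: "nat list"
  assumes "partition_of n \<alpha>"
    and "partition_of k \<theta>"
    and "diagram \<theta> \<subseteq> diagram \<alpha>"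
  shows "kronecker (skew_schur \<alpha> \<theta>) (schur [int n - int k - 1, 1]) =
      of_int (int (card (corners \<alpha>)) - int (card (corners \<theta>)) - 1) * skew_schur \<alpha> \<theta>
      + (\<Sum>\<beta> \<in> move_box \<alpha>. skew_schur \<beta> \<theta>)
      - (\<Sum>\<phi> \<in> move_box \<theta>. skew_schur \<alpha> \<phi>)"
proof -
  have p: "is_partition \<alpha>" "is_partition \<theta>" and sz: "sum_list \<alpha> = n" "sum_list \<theta> = k"
    using assms by (auto simp: partition_of_def)
  have "k \<le> n"
    using card_mono[OF finite_boxes[OF shape_row_lengths[OF p(1)]] assms(3)[unfolded diagram_eq_boxes]]
    by (simp add: card_boxes_row_lengths sz)
  then have m: "int n - int k - 1 = int (n - k) - 1" by simp
  show ?thesis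
    unfolding m schur_hook skew_schur_eq_shape_schur card_corners[OF p(1)] card_corners[OF p(2)]
      sum_move_box[OF p(1), of "\<lambda>h. shape_schur h (row_lengths \<theta>)"] sum_move_box[OF p(2), of "shape_schur (row_lengths \<alpha>)"]
    by (rule kronecker_shape_schur[OF shape_row_lengths[OF p(2)] shape_row_lengths[OF p(1)]]) (simp add: card_boxes_row_lengths sz)
qed

end
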